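(* Let $\mathcal{U}$ be the Markov upper cluster algebra and let $\Bbbk$ be a field. - (A) For each $\alpha\in\Bbbk$, there is a deep point $p\in V(\mathcal{U},\Bbbk)$ which sends $(x,y,z,M)\mapsto(0,0,0,\alpha)$. - (X) For each $\beta,\gamma\in\Bbbk$ with $\beta^2+\gamma^2=0$, there is a deep point $p\in V(\mathcal{U},\Bbbk)$ which sends $(x,y,z,M)\mapsto(0,\beta,\gamma,0)$. - (Y) For each $\beta,\gamma\in\Bbbk$ with $\beta^2+\gamma^2=0$, there is a deep point $p\in V(\mathcal{U},\Bbbk)$ which sends $(x,y,z,M)\mapsto(\beta,0,\gamma,0)$. - (Z) For each $\beta,\gamma\in\Bbbk$ with $\beta^2+\gamma^2=0$, there is a deep point $p\in V(\mathcal{U},\Bbbk)$ which sends $(x,y,z,M)\mapsto(\beta,\gamma,0,0)$. Every deep point in $V(\mathcal{U},\Bbbk)$ is one of these four types, which are pairwise disjoint except for the point which sends $(x,y,z,M)$ to $(0,0,0,0)$.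
   Context: The Markov cluster algebra $\mathcal{A}$ is the cluster algebra over $\mathbb{Z}$ (no frozen variables) of the Markov quiver, with initial cluster $\{x,y,z\}$ and two arrows $x\to y$, two arrows $y\to z$ and two arrows $z\to x$. Concretely, $\mathcal{A}\subset\mathbb{Q}(x,y,z)$, and each cluster $\{\overline{x},\overline{y},\overline{z}\}$ mutates by replacing one element as follows: $\overline{x}\mapsto(\overline{y}^2+\overline{z}^2)/\overline{x}$, $\overline{y}\mapsto(\overline{x}^2+\overline{z}^2)/\overline{y}$, or $\overline{z}\mapsto(\overline{x}^2+\overline{y}^2)/\overline{z}$. The Markov upper cluster algebra $\mathcal{U}$ is the intersection in $\mathbb{Q}(x,y,z)$ of the Laurent polynomial rings $\mathbb{Z}[\overline{x}^{\pm1},\overline{y}^{\pm1},\overline{z}^{\pm1}]$ over all clusters. The Markov element is $M=\frac{x^2+y^2+z^2}{xyz}$, which belongs to $\mathcal{U}$. It is a known result (Matherne--Muller) that $\mathcal{U}\simeq\mathbb{Z}[x,y,z,M]/\langle xyzM-x^2-y^2-z^2\rangle$. $V(\mathcal{U},\Bbbk)=\mathrm{Hom}_{\mathrm{Ring}}(\mathcal{U},\Bbbk)$. A point $p\in V(\mathcal{U},\Bbbk)$ is deep if every cluster contains a cluster variable which $p$ sends to $0$. *)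

theory Defs
  imports
    "HOL-Computational_Algebra.Computational_Algebra"
    "HOL-Library.FuncSet"
begin

(* Q(x,y,z), as the fraction field of Q[x][y][z]. *)
type_synonym ratfun = "rat poly poly poly fract"

definition var_x :: ratfun where "var_x = Fract [:[:[:0, 1:]:]:] 1"
definition var_y :: ratfun where "var_y = Fract [:[:0, 1:]:] 1"
definition var_z :: ratfun where "var_z = Fract [:0, 1:] 1"

(* Clusters are kept as ordered triples, so that mutation acts on a position;
   every mutation of the Markov quiver only reverses its arrows, which is why the
   exchange relations have the same shape at every cluster. *)
inductive markov_cluster :: "ratfun \<Rightarrow> ratfun \<Rightarrow> ratfun \<Rightarrow> bool" where
  initial: "markov_cluster var_x var_y var_z"
| mutate_1: "markov_cluster a b c \<Longrightarrow> markov_cluster ((b^2 + c^2) / a) b c"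
| mutate_2: "markov_cluster a b c \<Longrightarrow> markov_cluster a ((a^2 + c^2) / b) c"
| mutate_3: "markov_cluster a b c \<Longrightarrow> markov_cluster a b ((a^2 + b^2) / c)"

definition laurent_ring :: "ratfun \<Rightarrow> ratfun \<Rightarrow> ratfun \<Rightarrow> ratfun set" where
  "laurent_ring a b c =
     {f. \<exists>(S :: (int \<times> int \<times> int) set) (u :: int \<Rightarrow> int \<Rightarrow> int \<Rightarrow> int). finite S \<and>
           f = (\<Sum>(i, j, k)\<in>S. of_int (u i j k) * a powi i * b powi j * c powi k)}"

definition markov_upper :: "ratfun set" where
  "markov_upper = {f. \<forall>a b c. markov_cluster a b c \<longrightarrow> f \<in> laurent_ring a b c}"

definition markov_element :: ratfun where
  "markov_element = (var_x^2 + var_y^2 + var_z^2) / (var_x * var_y * var_z)"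

(* Unital ring homomorphisms from the upper cluster algebra to the field. They are
   normalised to be undefined off the algebra, so that equality of functions is
   equality of homomorphisms. *)
definition points :: "(ratfun \<Rightarrow> 'k::field) set" where
  "points = {p \<in> extensional markov_upper.
     p 1 = 1 \<and>
     (\<forall>f\<in>markov_upper. \<forall>g\<in>markov_upper. p (f + g) = p f + p g) \<and>
     (\<forall>f\<in>markov_upper. \<forall>g\<in>markov_upper. p (f * g) = p f * p g)}"

(* Cluster variables lie in the upper cluster algebra by the Laurent phenomenon. *)
definition deep_points :: "(ratfun \<Rightarrow> 'k::field) set" where
  "deep_points = {p \<in> points.
     \<forall>a b c. markov_cluster a b c \<longrightarrow> (\<exists>v\<in>{a, b, c}. p v = 0)}"

definition coords :: "(ratfun \<Rightarrow> 'k) \<Rightarrow> 'k \<times> 'k \<times> 'k \<times> 'k" where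
  "coords p = (p var_x, p var_y, p var_z, p markov_element)"

definition type_A :: "(ratfun \<Rightarrow> 'k::field) set" where
  "type_A = {p \<in> deep_points. \<exists>\<alpha>. coords p = (0, 0, 0, \<alpha>)}"

definition type_X :: "(ratfun \<Rightarrow> 'k::field) set" where
  "type_X = {p \<in> deep_points. \<exists>\<beta> \<gamma>. \<beta>^2 + \<gamma>^2 = 0 \<and> coords p = (0, \<beta>, \<gamma>, 0)}"

definition type_Y :: "(ratfun \<Rightarrow> 'k::field) set" where
  "type_Y = {p \<in> deep_points. \<exists>\<beta> \<gamma>. \<beta>^2 + \<gamma>^2 = 0 \<and> coords p = (\<beta>, 0, \<gamma>, 0)}"

definition type_Z :: "(ratfun \<Rightarrow> 'k::field) set" where
  "type_Z = {p \<in> deep_points. \<exists>\<beta> \<gamma>. \<beta>^2 + \<gamma>^2 = 0 \<and> coords p = (\<beta>, \<gamma>, 0, 0)}"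

end

theory Submission
  imports Defs
begin

text \<open>
  Write \<open>B = \<int>[x, y, z, M]\<close> for the subring of \<open>\<rat>(x, y, z)\<close> generated by the initial cluster and the
  Markov element. In terms of values at \<open>x, y, z, M\<close> the classification of deep points is short. The
  relation \<open>x y z M = x\<^sup>2 + y\<^sup>2 + z\<^sup>2\<close> holds at every cluster with the same \<open>M\<close>, so the mutation at \<open>x\<close> is
  \<open>x \<mapsto> y z M - x\<close>. If \<open>x, y, z\<close> all vanish at a point, then so do all cluster variables; if \<open>M\<close> vanishes,
  mutations are sign changes and one vanishing variable stays at zero. Conversely, if \<open>x\<close> vanishes at a
  deep point, then \<open>y\<^sup>2 + z\<^sup>2 = 0\<close>, and the cluster obtained by mutating \<open>x\<close> shows \<open>y z M = 0\<close>; this leaves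
  \<open>y = z = 0\<close> or \<open>M = 0\<close> (\<open>deep_point_cases\<close>).

  The real content is that points correspond to solutions of the Markov relation. This takes two facts.

  The upper cluster algebra is \<open>B\<close> (\<open>markov_upper_eq\<close>), so a point is determined by its four
  coordinates. That \<open>B\<close> is contained in every Laurent ring is clear, since mutation does not change the
  ring generated by the cluster and \<open>M\<close>. For the converse, let \<open>f\<close> be Laurent in the initial cluster and
  in its three neighbours, say \<open>(x y z)\<^sup>k f \<in> B\<close> and \<open>(x' y z)\<^sup>l f \<in> B\<close> with \<open>x' = y z M - x\<close>. In
  \<open>B / x B = \<int>[y, z, M] / (y\<^sup>2 + z\<^sup>2)\<close> none of \<open>y\<close>, \<open>z\<close>, \<open>x' = y z M\<close> is a zero divisor (\<open>x_cancel\<close>), so the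
  power of \<open>x\<close> can be dropped from the denominator of \<open>f\<close>. The same argument with \<open>y\<close> and \<open>z\<close> removes the
  rest of the denominator. Cancelling \<open>y\<close> modulo \<open>y\<^sup>2 + z\<^sup>2\<close> is a matter of setting \<open>y = 0\<close>.

  Every solution of the relation over a commutative ring is realised by a homomorphism
  (\<open>ring_hom_exists\<close>). Indeed \<open>y, z, M\<close> are algebraically independent and \<open>B\<close> is free over \<open>\<int>[y, z, M]\<close> with
  basis \<open>1, x\<close>, because \<open>x\<close> is a root of \<open>T\<^sup>2 - y z M T + y\<^sup>2 + z\<^sup>2\<close>. The independence is read off from the
  lowest and highest powers of \<open>x\<close> in the powers of \<open>M\<close> (\<open>markov_relation_independent\<close>). A homomorphism
  can therefore be prescribed freely on \<open>y, z, M\<close> and sends \<open>x\<close> to any root of the image quadratic.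
\<close>

section \<open>Subrings, adjunction and ring homomorphisms\<close>

definition is_subring :: "'a::comm_ring_1 set \<Rightarrow> bool" where
  "is_subring R \<longleftrightarrow> 1 \<in> R \<and> (\<forall>a\<in>R. \<forall>b\<in>R. a - b \<in> R \<and> a * b \<in> R)"

lemma is_subring_0: "is_subring R \<Longrightarrow> 0 \<in> R"
  by (metis is_subring_def diff_self)

lemma is_subring_1: "is_subring R \<Longrightarrow> 1 \<in> R"
  by (simp add: is_subring_def)

lemma is_subring_diff: "is_subring R \<Longrightarrow> a \<in> R \<Longrightarrow> b \<in> R \<Longrightarrow> a - b \<in> R"
  by (simp add: is_subring_def)

lemma is_subring_mult: "is_subring R \<Longrightarrow> a \<in> R \<Longrightarrow> b \<in> R \<Longrightarrow> a * b \<in> R"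
  by (simp add: is_subring_def)

lemma is_subring_minus: "is_subring R \<Longrightarrow> a \<in> R \<Longrightarrow> - a \<in> R"
  by (metis is_subring_0 is_subring_diff diff_0)

lemma is_subring_add: "is_subring R \<Longrightarrow> a \<in> R \<Longrightarrow> b \<in> R \<Longrightarrow> a + b \<in> R"
  by (metis is_subring_minus is_subring_diff diff_minus_eq_add)

lemma is_subring_power: "is_subring R \<Longrightarrow> a \<in> R \<Longrightarrow> a ^ n \<in> R"
  by (induction n) (auto simp: is_subring_1 is_subring_mult)

lemma is_subring_sum: "is_subring R \<Longrightarrow> (\<And>i. i \<in> S \<Longrightarrow> f i \<in> R) \<Longrightarrow> sum f S \<in> R"
  by (induction S rule: infinite_finite_induct) (auto simp: is_subring_0 is_subring_add)

lemma is_subring_of_int: "is_subring R \<Longrightarrow> of_int k \<in> R"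
proof -
  assume R: "is_subring R"
  have nat: "of_nat n \<in> R" for n
    by (induction n) (auto simp: R is_subring_0 is_subring_1 is_subring_add)
  show ?thesis
    by (cases k rule: int_cases2) (auto simp: R nat is_subring_minus)
qed

lemmas is_subring_closed =
  is_subring_0 is_subring_1 is_subring_diff is_subring_mult is_subring_minus is_subring_add
  is_subring_power is_subring_of_int

abbreviation subring_gen :: "'a::comm_ring_1 set \<Rightarrow> 'a set" where
  "subring_gen S \<equiv> is_subring hull S"

lemma is_subring_gen [simp]: "is_subring (subring_gen S)"
  by (rule hull_in) (auto simp: is_subring_def)

lemma subring_gen_empty: "subring_gen {} = range of_int"
proof (rule hull_unique)
  show "is_subring (range of_int :: 'a set)"
    unfolding is_subring_def by (auto simp flip: of_int_diff of_int_mult intro: range_eqI[of _ _ 1])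
qed (auto simp: is_subring_of_int)

text \<open>
  The subring obtained by adjoining \<open>t\<close> to a subring \<open>A\<close> of a field is handled through polynomials
  over the ambient field whose coefficients happen to lie in \<open>A\<close>. Thus \<open>A\<close> never has to become a type,
  and towers of adjunctions need no nested polynomial types.
\<close>

definition polys_over :: "'a::zero set \<Rightarrow> 'a poly set" where
  "polys_over A = {p. \<forall>i. coeff p i \<in> A}"

lemma polys_over_coeff: "p \<in> polys_over A \<Longrightarrow> coeff p i \<in> A"
  by (simp add: polys_over_def)

lemma is_subring_polys_over: "is_subring A \<Longrightarrow> is_subring (polys_over A)"
  unfolding polys_over_def is_subring_def[of "{p. _ p}"]
  by (auto simp: coeff_mult is_subring_closed intro!: is_subring_sum)

lemma pCons_polys_over: "a \<in> A \<Longrightarrow> p \<in> polys_over A \<Longrightarrow> pCons a p \<in> polys_over A"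
  by (auto simp: polys_over_def coeff_pCons split: nat.splits)

lemma zero_polys_over: "is_subring A \<Longrightarrow> 0 \<in> polys_over A"
  by (simp add: polys_over_def is_subring_0)

lemma smult_polys_over: "is_subring A \<Longrightarrow> a \<in> A \<Longrightarrow> p \<in> polys_over A \<Longrightarrow> smult a p \<in> polys_over A"
  by (simp add: polys_over_def is_subring_mult)

lemma poly_in_subring:
  assumes "is_subring R" "p \<in> polys_over R" "t \<in> R"
  shows "poly p t \<in> R"
  unfolding poly_altdef using assms
  by (auto intro!: is_subring_sum is_subring_mult is_subring_power dest: polys_over_coeff)

lemma subring_gen_insert:
  assumes A: "is_subring A"
  shows "subring_gen (insert t A) = (\<lambda>p. poly p t) ` polys_over A"
proof (rule hull_unique)
  have "a \<in> (\<lambda>p. poly p t) ` polys_over A" if "a \<in> A" for a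
    using that A by (intro image_eqI[of _ _ "[:a:]"]) (auto simp: pCons_polys_over zero_polys_over)
  moreover have "t \<in> (\<lambda>p. poly p t) ` polys_over A"
    using A by (intro image_eqI[of _ _ "[:0, 1:]"])
      (auto simp: pCons_polys_over zero_polys_over is_subring_0 is_subring_1)
  ultimately show "insert t A \<subseteq> (\<lambda>p. poly p t) ` polys_over A" by blast
  note P = is_subring_polys_over[OF A]
  show "is_subring ((\<lambda>p. poly p t) ` polys_over A)"
    unfolding is_subring_def
  proof (intro conjI ballI; (elim imageE)?)
    show "1 \<in> (\<lambda>p. poly p t) ` polys_over A"
      using is_subring_1[OF P] by (intro image_eqI[of _ _ 1]) auto
    fix a b p q assume *: "a = poly p t" "p \<in> polys_over A" "b = poly q t" "q \<in> polys_over A"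
    show "a - b \<in> (\<lambda>p. poly p t) ` polys_over A"
      using * is_subring_diff[OF P] by (intro image_eqI[of _ _ "p - q"]) auto
    show "a * b \<in> (\<lambda>p. poly p t) ` polys_over A"
      using * is_subring_mult[OF P] by (intro image_eqI[of _ _ "p * q"]) auto
  qed
next
  fix R assume "insert t A \<subseteq> R" "is_subring R"
  then show "(\<lambda>p. poly p t) ` polys_over A \<subseteq> R"
    using poly_in_subring[of R _ t] unfolding polys_over_def by blast
qed

text \<open>
  The relation lets every power of \<open>x\<close> be reduced to degree at most one, so \<open>1, x\<close> span over \<open>C\<close>.
\<close>

lemma subring_gen_insert_quadratic:
  assumes C: "is_subring C" and mn: "m \<in> C" "n \<in> C" and x2: "x * x = m * x - n"
  shows "subring_gen (insert x C) = {c + x * d | c d. c \<in> C \<and> d \<in> C}"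
proof (rule hull_unique)
  have "c = c + x * 0" "x = 0 + x * 1" for c by auto
  then show "insert x C \<subseteq> {c + x * d | c d. c \<in> C \<and> d \<in> C}"
    using is_subring_0[OF C] is_subring_1[OF C] by blast
  show "is_subring {c + x * d | c d. c \<in> C \<and> d \<in> C}"
    unfolding is_subring_def
  proof (intro conjI ballI)
    show "1 \<in> {c + x * d | c d. c \<in> C \<and> d \<in> C}"
      using is_subring_0[OF C] is_subring_1[OF C] by force
    fix a b assume "a \<in> {c + x * d | c d. c \<in> C \<and> d \<in> C}" "b \<in> {c + x * d | c d. c \<in> C \<and> d \<in> C}"
    then obtain c d c' d' where *: "a = c + x * d" "b = c' + x * d'"
      and cd: "c \<in> C" "d \<in> C" "c' \<in> C" "d' \<in> C" by blast
    have "a - b = (c - c') + x * (d - d')" using * by (simp add: algebra_simps)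
    then show "a - b \<in> {c + x * d | c d. c \<in> C \<and> d \<in> C}"
      using cd C is_subring_diff by blast
    have "a * b = c * c' + x * (c * d' + d * c') + (x * x) * (d * d')"
      unfolding * by (simp add: algebra_simps)
    also have "\<dots> = (c * c' - n * (d * d')) + x * (c * d' + d * c' + m * (d * d'))"
      unfolding x2 by (simp add: algebra_simps)
    finally show "a * b \<in> {c + x * d | c d. c \<in> C \<and> d \<in> C}"
      using cd C mn by (blast intro: is_subring_closed)
  qed
next
  fix R assume "insert x C \<subseteq> R" "is_subring R"
  then show "{c + x * d | c d. c \<in> C \<and> d \<in> C} \<subseteq> R"
    by (auto intro!: is_subring_add is_subring_mult)
qed

definition ring_hom_on :: "'a::comm_ring_1 set \<Rightarrow> ('a \<Rightarrow> 'b::comm_ring_1) \<Rightarrow> bool" where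
  "ring_hom_on R h \<longleftrightarrow> h 1 = 1 \<and> (\<forall>f\<in>R. \<forall>g\<in>R. h (f + g) = h f + h g) \<and>
     (\<forall>f\<in>R. \<forall>g\<in>R. h (f * g) = h f * h g)"

lemma ring_hom_on_add: "ring_hom_on R h \<Longrightarrow> f \<in> R \<Longrightarrow> g \<in> R \<Longrightarrow> h (f + g) = h f + h g"
  by (simp add: ring_hom_on_def)

lemma ring_hom_on_mult: "ring_hom_on R h \<Longrightarrow> f \<in> R \<Longrightarrow> g \<in> R \<Longrightarrow> h (f * g) = h f * h g"
  by (simp add: ring_hom_on_def)

lemma ring_hom_on_1: "ring_hom_on R h \<Longrightarrow> h 1 = 1"
  by (simp add: ring_hom_on_def)

lemma ring_hom_on_0: "is_subring R \<Longrightarrow> ring_hom_on R h \<Longrightarrow> h 0 = 0"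
  by (metis add.right_neutral add_cancel_left_right is_subring_0 ring_hom_on_add)

lemma ring_hom_on_diff:
  assumes "is_subring R" "ring_hom_on R h" "f \<in> R" "g \<in> R"
  shows "h (f - g) = h f - h g"
  using ring_hom_on_add[OF assms(2), of "f - g" g] assms by (simp add: is_subring_diff)

lemma ring_hom_on_sum:
  assumes "is_subring R" "ring_hom_on R h" "\<And>i. i \<in> S \<Longrightarrow> f i \<in> R"
  shows "h (sum f S) = (\<Sum>i\<in>S. h (f i))"
  using assms(3)
  by (induction S rule: infinite_finite_induct)
     (auto simp: ring_hom_on_0[OF assms(1,2)] ring_hom_on_add[OF assms(2)] is_subring_sum[OF assms(1)])

text \<open>
  The elements on which two homomorphisms agree form a subring.
\<close>

lemma ring_hom_on_eqI:
  assumes h: "ring_hom_on (subring_gen S) h" and h': "ring_hom_on (subring_gen S) h'"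
    and eq: "\<And>s. s \<in> S \<Longrightarrow> h s = h' s" and f: "f \<in> subring_gen S"
  shows "h f = h' f"
proof -
  let ?E = "{f \<in> subring_gen S. h f = h' f}"
  have "is_subring ?E"
    unfolding is_subring_def[of ?E]
    by (auto simp: is_subring_closed ring_hom_on_diff[OF is_subring_gen h]
        ring_hom_on_diff[OF is_subring_gen h'] ring_hom_on_mult[OF h] ring_hom_on_mult[OF h']
        ring_hom_on_1[OF h] ring_hom_on_1[OF h'])
  moreover have "S \<subseteq> ?E" using eq by (auto intro: hull_inc)
  ultimately show ?thesis using f hull_minimal[of S ?E is_subring] by blast
qed

section \<open>Transcendental elements\<close>

definition transcendental_over :: "'a::comm_ring_1 \<Rightarrow> 'a set \<Rightarrow> bool" where
  "transcendental_over t A \<longleftrightarrow> (\<forall>p\<in>polys_over A. poly p t = 0 \<longrightarrow> p = 0)"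

lemma transcendental_overD:
  "transcendental_over t A \<Longrightarrow> p \<in> polys_over A \<Longrightarrow> poly p t = 0 \<Longrightarrow> p = 0"
  by (simp add: transcendental_over_def)

lemma transcendental_over_mono: "transcendental_over t B \<Longrightarrow> A \<subseteq> B \<Longrightarrow> transcendental_over t A"
  by (auto simp: transcendental_over_def polys_over_def)

lemma transcendental_over_inj:
  assumes "is_subring A" "transcendental_over t A"
  shows "inj_on (\<lambda>p. poly p t) (polys_over A)"
proof (rule inj_onI)
  fix p q assume *: "p \<in> polys_over A" "q \<in> polys_over A" "poly p t = poly q t"
  then have "p - q \<in> polys_over A" using assms(1) is_subring_polys_over is_subring_diff by blast
  then show "p = q" using transcendental_overD[OF assms(2), of "p - q"] * by simp
qed

lemma transcendental_over_nonzero: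
  assumes "is_subring A" "transcendental_over t A" shows "t \<noteq> 0"
  using transcendental_overD[OF assms(2), of "[:0, 1:]"] assms(1)
  by (auto simp: pCons_polys_over zero_polys_over is_subring_0 is_subring_1)

text \<open>
  The symmetry of algebraic independence. A relation for \<open>s\<close> with coefficients in \<open>A[t]\<close> is a double
  sum in powers of \<open>s\<close> and \<open>t\<close>; collecting by powers of \<open>t\<close> instead gives a relation for \<open>t\<close> over \<open>A[s]\<close>,
  so each coefficient, itself a polynomial in \<open>s\<close> over \<open>A\<close>, vanishes. This is what makes the three
  coordinates interchangeable although the field of rational functions is built by adjoining them in
  a fixed order.
\<close>

lemma transcendental_over_exchange:
  fixes s t :: "'a::comm_ring_1"
  assumes A: "is_subring A" and s: "transcendental_over s A"
    and t: "transcendental_over t (subring_gen (insert s A))"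
  shows "transcendental_over s (subring_gen (insert t A))"
  unfolding transcendental_over_def
proof (intro ballI impI)
  fix p assume p: "p \<in> polys_over (subring_gen (insert t A))" and p0: "poly p s = 0"
  have "\<forall>i. \<exists>q\<in>polys_over A. coeff p i = poly q t"
    using p unfolding subring_gen_insert[OF A] polys_over_def by auto
  then obtain q where q: "\<And>i. q i \<in> polys_over A" and pq: "\<And>i. coeff p i = poly (q i) t"
    by metis
  define n where "n = degree p"
  \<comment> \<open>a common degree bound for the coefficients, so that the double sum is a rectangle\<close>
  define d where "d = Max (degree ` q ` {..n})"
  have d: "poly (q i) t = (\<Sum>j\<le>d. coeff (q i) j * t ^ j)" if "i \<le> n" for i
  proof -
    have "degree (q i) \<le> d" unfolding d_def using that by (intro Max_ge) auto
    then show ?thesis unfolding poly_altdef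
      by (intro sum.mono_neutral_left) (auto simp: coeff_eq_0)
  qed
  define r where "r = (\<Sum>j\<le>d. monom (\<Sum>i\<le>n. coeff (q i) j * s ^ i) j)"
  have cr: "coeff r j = (if j \<le> d then \<Sum>i\<le>n. coeff (q i) j * s ^ i else 0)" for j
    by (simp add: r_def coeff_sum if_distrib sum.delta cong: if_cong)
  have SA: "(\<Sum>i\<le>n. coeff (q i) j * s ^ i) = poly (\<Sum>i\<le>n. monom (coeff (q i) j) i) s" for j
    by (simp add: poly_sum poly_monom)
  have mon: "(\<Sum>i\<le>n. monom (coeff (q i) j) i) \<in> polys_over A" for j
    using q A by (auto simp: polys_over_def coeff_sum if_distrib sum.delta is_subring_0 cong: if_cong)
  have "r \<in> polys_over (subring_gen (insert s A))"
    unfolding polys_over_def[of "subring_gen (insert s A)"] mem_Collect_eq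
  proof
    fix j
    have "(\<Sum>i\<le>n. coeff (q i) j * s ^ i) \<in> subring_gen (insert s A)"
      unfolding SA subring_gen_insert[OF A] using mon by blast
    then show "coeff r j \<in> subring_gen (insert s A)"
      by (simp add: cr is_subring_0)
  qed
  moreover have "poly r t = poly p s"
  proof -
    have "poly r t = (\<Sum>j\<le>d. \<Sum>i\<le>n. coeff (q i) j * s ^ i * t ^ j)"
      by (simp add: r_def poly_sum poly_monom sum_distrib_right)
    also have "\<dots> = (\<Sum>i\<le>n. \<Sum>j\<le>d. coeff (q i) j * s ^ i * t ^ j)" by (rule sum.swap)
    also have "\<dots> = (\<Sum>i\<le>n. coeff p i * s ^ i)"
      by (intro sum.cong) (auto simp: pq d sum_distrib_left mult_ac)
    also have "\<dots> = poly p s" by (simp add: n_def poly_altdef)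
    finally show ?thesis .
  qed
  ultimately have r0: "r = 0" using transcendental_overD[OF t] p0 by simp
  have z: "coeff (q i) j = 0" if "i \<le> n" "j \<le> d" for i j
  proof -
    have "poly (\<Sum>i\<le>n. monom (coeff (q i) j) i) s = 0"
      using cr[of j] r0 that SA[of j] by simp
    then have "(\<Sum>i\<le>n. monom (coeff (q i) j) i) = 0"
      by (rule transcendental_overD[OF s mon])
    then have "coeff (\<Sum>i\<le>n. monom (coeff (q i) j) i) i = 0" by simp
    then show ?thesis using that by (simp add: coeff_sum if_distrib sum.delta cong: if_cong)
  qed
  have "coeff p i = 0" for i
  proof (cases "i \<le> n")
    case True
    then show ?thesis by (simp add: pq d z)
  next
    case False
    then show ?thesis by (simp add: n_def coeff_eq_0)
  qed
  then show "p = 0" by (simp add: poly_eq_iff)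
qed

text \<open>
  Since \<open>t\<close> is transcendental, an element of \<open>A[t]\<close> determines its polynomial, and evaluating that
  polynomial at any \<open>\<tau>\<close> is consistent.
\<close>

lemma ring_hom_on_extend_transcendental:
  fixes h :: "'a::comm_ring_1 \<Rightarrow> 'b::comm_ring_1"
  assumes A: "is_subring A" and t: "transcendental_over t A" and h: "ring_hom_on A h"
  obtains h' where "ring_hom_on (subring_gen (insert t A)) h'" "\<And>a. a \<in> A \<Longrightarrow> h' a = h a" "h' t = \<tau>"
proof -
  define P where "P = inv_into (polys_over A) (\<lambda>p. poly p t)"
  have P: "P (poly p t) = p" if "p \<in> polys_over A" for p
    unfolding P_def using inv_into_f_f[OF transcendental_over_inj[OF A t] that] by simp
  define h' where "h' f = poly (map_poly h (P f)) \<tau>" for f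
  note h0 = ring_hom_on_0[OF A h] and h1 = ring_hom_on_1[OF h]
  have h': "h' (poly p t) = poly (map_poly h p) \<tau>" if "p \<in> polys_over A" for p
    using P[OF that] by (simp add: h'_def)
  have const: "[:a:] \<in> polys_over A" if "a \<in> A" for a
    using that by (simp add: pCons_polys_over zero_polys_over A)
  have on_A: "h' a = h a" if "a \<in> A" for a
    using h'[OF const[OF that]] by (simp add: map_poly_pCons h0)
  note SP = is_subring_polys_over[OF A]
  have add: "map_poly h (p + q) = map_poly h p + map_poly h q"
    if "p \<in> polys_over A" "q \<in> polys_over A" for p q
    using that by (intro poly_eqI)
      (simp add: coeff_map_poly h0 ring_hom_on_add[OF h] polys_over_coeff)
  have mult: "map_poly h (p * q) = map_poly h p * map_poly h q"
    if "p \<in> polys_over A" "q \<in> polys_over A" for p q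
    using that by (intro poly_eqI)
      (simp add: coeff_map_poly h0 coeff_mult ring_hom_on_sum[OF A h] ring_hom_on_mult[OF h]
        polys_over_coeff is_subring_mult[OF A])
  have "ring_hom_on (subring_gen (insert t A)) h'"
    unfolding ring_hom_on_def subring_gen_insert[OF A]
  proof (intro conjI ballI; (elim imageE)?)
    show "h' 1 = 1" using on_A[of 1] is_subring_1[OF A] h1 by simp
  next
    fix f g p q assume "f = poly p t" "p \<in> polys_over A" "g = poly q t" "q \<in> polys_over A"
    then show "h' (f + g) = h' f + h' g" "h' (f * g) = h' f * h' g"
      using h'[of "p + q"] h'[of "p * q"] is_subring_add[OF SP] is_subring_mult[OF SP]
      by (simp_all add: h' add mult)
  qed
  moreover have "h' t = \<tau>"
    using h'[of "[:0, 1:]"] A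
    by (simp add: pCons_polys_over zero_polys_over is_subring_0 is_subring_1 map_poly_pCons h0 h1)
  ultimately show thesis using that on_A by blast
qed

text \<open>
  Elements of \<open>C[x]\<close> are uniquely \<open>c + x d\<close>, and the only obstruction to sending \<open>x\<close> to \<open>\<xi>\<close> is the
  quadratic equation itself.
\<close>

lemma ring_hom_on_extend_quadratic:
  fixes h :: "'a::comm_ring_1 \<Rightarrow> 'b::comm_ring_1"
  assumes C: "is_subring C" and mn: "m \<in> C" "n \<in> C" and x2: "x * x = m * x - n"
    and ind: "\<And>c d. c \<in> C \<Longrightarrow> d \<in> C \<Longrightarrow> c + x * d = 0 \<Longrightarrow> c = 0 \<and> d = 0"
    and h: "ring_hom_on C h" and \<xi>: "\<xi> * \<xi> = h m * \<xi> - h n"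
  obtains h' where "ring_hom_on (subring_gen (insert x C)) h'" "\<And>c. c \<in> C \<Longrightarrow> h' c = h c" "h' x = \<xi>"
proof -
  let ?e = "\<lambda>(c, d). c + x * d"
  have inj: "inj_on ?e (C \<times> C)"
  proof (rule inj_onI, clarify)
    fix c d c' d' assume *: "c \<in> C" "d \<in> C" "c' \<in> C" "d' \<in> C" "c + x * d = c' + x * d'"
    have "(c - c') + x * (d - d') = 0" using *(5) by (simp add: algebra_simps)
    with ind[of "c - c'" "d - d'"] * C show "c = c' \<and> d = d'" by (simp add: is_subring_diff)
  qed
  define h' where "h' f = (case inv_into (C \<times> C) ?e f of (c, d) \<Rightarrow> h c + \<xi> * h d)" for f
  have h': "h' (c + x * d) = h c + \<xi> * h d" if "c \<in> C" "d \<in> C" for c d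
    using inv_into_f_f[OF inj, of "(c, d)"] that by (simp add: h'_def)
  note h0 = ring_hom_on_0[OF C h] and h1 = ring_hom_on_1[OF h]
  note ha = ring_hom_on_add[OF h] and hm = ring_hom_on_mult[OF h] and hd = ring_hom_on_diff[OF C h]
  have on_C: "h' c = h c" if "c \<in> C" for c
    using h'[OF that is_subring_0[OF C]] by (simp add: h0)
  have "ring_hom_on (subring_gen (insert x C)) h'"
    unfolding ring_hom_on_def subring_gen_insert_quadratic[OF C mn x2]
  proof (intro conjI ballI)
    show "h' 1 = 1" using on_C[of 1] is_subring_1[OF C] h1 by simp
  next
    fix f g assume "f \<in> {c + x * d | c d. c \<in> C \<and> d \<in> C}" "g \<in> {c + x * d | c d. c \<in> C \<and> d \<in> C}"
    then obtain c d c' d' where *: "f = c + x * d" "g = c' + x * d'"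
      and cd: "c \<in> C" "d \<in> C" "c' \<in> C" "d' \<in> C" by blast
    have "f + g = (c + c') + x * (d + d')" using * by (simp add: algebra_simps)
    then show "h' (f + g) = h' f + h' g"
      using h'[of "c + c'" "d + d'"] h'[of c d] h'[of c' d'] cd C
      by (simp add: * ha is_subring_add algebra_simps)
    have "f * g = c * c' + x * (c * d' + d * c') + (x * x) * (d * d')"
      unfolding * by (simp add: algebra_simps)
    also have "\<dots> = (c * c' - n * (d * d')) + x * (c * d' + d * c' + m * (d * d'))"
      unfolding x2 by (simp add: algebra_simps)
    finally have "h' (f * g) = h (c * c' - n * (d * d')) + \<xi> * h (c * d' + d * c' + m * (d * d'))"
      using cd C mn by (simp add: h' is_subring_closed)
    also have "\<dots> = h c * h c' - h n * (h d * h d') + \<xi> * (h c * h d' + h d * h c' + h m * (h d * h d'))"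
      using cd C mn by (simp add: ha hm hd is_subring_closed)
    also have "\<dots> = h c * h c' + \<xi> * (h c * h d' + h d * h c') + (\<xi> * \<xi>) * (h d * h d')"
      unfolding \<xi> by (simp add: algebra_simps)
    also have "\<dots> = h' f * h' g"
      unfolding * h'[OF cd(1,2)] h'[OF cd(3,4)] by (simp add: algebra_simps)
    finally show "h' (f * g) = h' f * h' g" .
  qed
  moreover have "h' x = \<xi>"
    using h'[OF is_subring_0[OF C] is_subring_1[OF C]] by (simp add: h0 h1)
  ultimately show thesis using that on_C by blast
qed

lemma ring_hom_on_integers:
  obtains h where "ring_hom_on (subring_gen {} :: 'a::field_char_0 set) (h :: 'a \<Rightarrow> 'b::comm_ring_1)"
proof
  define h :: "'a \<Rightarrow> 'b" where "h f = of_int (inv of_int f)" for f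
  have h: "h (of_int k) = of_int k" for k
    by (simp add: h_def inv_f_f inj_def)
  show "ring_hom_on (subring_gen {}) h"
    unfolding subring_gen_empty ring_hom_on_def
  proof (intro conjI ballI; (elim rangeE)?)
    show "h 1 = 1" using h[of 1] by simp
    fix f g :: 'a and i j assume "f = of_int i" "g = of_int j"
    then show "h (f + g) = h f + h g" "h (f * g) = h f * h g"
      using h[of "i + j"] h[of "i * j"] by (simp_all add: h)
  qed
qed

section \<open>The quadratic extension cut out by the Markov relation\<close>

text \<open>
  The relation gives \<open>M = (x\<^sup>2 + s) / (x w)\<close>. As a Laurent polynomial in \<open>x\<close>, the power \<open>M\<^sup>l\<close> therefore runs
  from \<open>x\<^sup>-\<^sup>l\<close>, with coefficient \<open>(s/w)\<^sup>l\<close>, up to \<open>x\<^sup>l\<close>, with coefficient \<open>(1/w)\<^sup>l\<close>. If \<open>L\<close> is the larger of the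
  degrees of \<open>u\<close> and \<open>v\<close>, then in \<open>u(M) + x v(M)\<close> the exponent \<open>-L\<close> arises only from the leading term
  of \<open>u\<close> and the exponent \<open>L + 1\<close> only from that of \<open>v\<close>, so both leading terms vanish. Multiplying by
  \<open>(x w)\<^sup>L\<close> turns these two extreme coefficients into those at \<open>x\<^sup>0\<close> and at \<open>x\<^sup>2\<^sup>L\<^sup>+\<^sup>1\<close> of an honest
  polynomial \<open>F\<close>.
\<close>

lemma markov_relation_independent:
  fixes x M :: "'a::field"
  assumes A: "is_subring A" and x: "transcendental_over x A"
    and s: "s \<in> A" "s \<noteq> 0" and w: "w \<in> A" "w \<noteq> 0" and rel: "M * (x * w) = x * x + s"
    and u: "u \<in> polys_over A" and v: "v \<in> polys_over A" and uv: "poly u M + x * poly v M = 0"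
  shows "u = 0 \<and> v = 0"
proof (rule ccontr)
  assume nz: "\<not> (u = 0 \<and> v = 0)"
  define L where "L = max (degree u) (degree v)"
  define G where "G l = [:coeff u l, coeff v l:] * [:s, 0, 1:] ^ l * [:0, w:] ^ (L - l)" for l
  define F where "F = (\<Sum>l\<le>L. G l)"
  have "G l \<in> polys_over A" for l
    unfolding G_def using A s w u v
    by (intro is_subring_mult is_subring_power is_subring_polys_over)
       (auto intro!: pCons_polys_over zero_polys_over is_subring_0 is_subring_1 is_subring_polys_over
         dest: polys_over_coeff)
  then have F: "F \<in> polys_over A"
    unfolding F_def by (intro is_subring_sum is_subring_polys_over A)
  have eval: "poly p M = (\<Sum>l\<le>L. coeff p l * M ^ l)" if "degree p \<le> L" for p :: "'a poly"
    unfolding poly_altdef using that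
    by (intro sum.mono_neutral_left) (auto simp: coeff_eq_0)
  have "poly (G l) x = (x * w) ^ L * (coeff u l * M ^ l + x * (coeff v l * M ^ l))" if "l \<le> L" for l
  proof -
    have "poly (G l) x = (coeff u l + x * coeff v l) * (x * x + s) ^ l * (x * w) ^ (L - l)"
      by (simp add: G_def algebra_simps)
    also have "\<dots> = (coeff u l + x * coeff v l) * M ^ l * ((x * w) ^ l * (x * w) ^ (L - l))"
      unfolding rel[symmetric] by (simp add: power_mult_distrib mult_ac)
    also have "(x * w) ^ l * (x * w) ^ (L - l) = (x * w) ^ L"
      using that by (simp flip: power_add)
    finally show ?thesis by (simp add: algebra_simps)
  qed
  then have "poly F x = (x * w) ^ L * (poly u M + x * poly v M)"
    by (simp add: F_def poly_sum eval L_def sum_distrib_left distrib_left sum.distrib)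
  then have F0: "F = 0"
    using transcendental_overD[OF x F] uv by simp
  have "poly (G l) 0 = (if l = L then coeff u L * s ^ L else 0)" if "l \<le> L" for l
    using that by (auto simp: G_def)
  then have "poly F 0 = coeff u L * s ^ L"
    by (simp add: F_def poly_sum)
  then have uL: "coeff u L = 0" using F0 s by simp
  have low: "coeff (G l) (2 * L + 1) = 0" if "l < L" for l
  proof (rule coeff_eq_0)
    have "degree (G l) \<le> degree [:coeff u l, coeff v l:] + degree ([:s, 0, 1:] ^ l)
        + degree ([:0, w:] ^ (L - l))"
      unfolding G_def by (meson add_mono degree_mult_le order_refl order_trans)
    also have "\<dots> \<le> 1 + 2 * l + 1 * (L - l)"
      by (intro add_mono order_trans[OF degree_power_le]) auto
    also have "\<dots> < 2 * L + 1" using that by simp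
    finally show "degree (G l) < 2 * L + 1" .
  qed
  have deg: "degree ([:s, 0, 1:] ^ L) = 2 * L"
    by (subst degree_power_eq) auto
  have lead: "coeff ([:s, 0, 1:] ^ L) (2 * L) = 1"
    using lead_coeff_power[of "[:s, 0, 1:]" L] unfolding deg by simp
  have "coeff (G L) (2 * L + 1) = coeff v L"
    using lead by (simp add: G_def coeff_eq_0 deg coeff_pCons)
  moreover have "coeff F (2 * L + 1) = coeff (G L) (2 * L + 1)"
    unfolding F_def coeff_sum
    by (subst sum.remove[of _ L]) (auto intro!: sum.neutral low simp del: add_Suc_right One_nat_def)
  ultimately have "coeff v L = 0" using F0 by simp
  with uL nz show False
    unfolding L_def max_def by (auto split: if_splits simp: leading_coeff_0_iff)
      (metis coeff_0 degree_0 le_zero_eq leading_coeff_0_iff)+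
qed

text \<open>
  If \<open>y a = (y\<^sup>2 + z\<^sup>2) b\<close>, putting \<open>y = 0\<close> gives \<open>z\<^sup>2 b(0) = 0\<close>; hence \<open>b\<close> is divisible by \<open>y\<close>, and \<open>y\<close> can be
  cancelled from the equation.
\<close>

lemma dvd_sum_squares_cancel:
  fixes y z :: "'a::field"
  assumes D: "is_subring D" and y: "transcendental_over y D" and z: "z \<in> D" "z \<noteq> 0"
    and a: "a \<in> subring_gen (insert y D)" and b: "b \<in> subring_gen (insert y D)"
    and eq: "y * a = (y * y + z * z) * b"
  shows "\<exists>c\<in>subring_gen (insert y D). a = (y * y + z * z) * c"
proof -
  obtain p q where p: "p \<in> polys_over D" "a = poly p y" and q: "q \<in> polys_over D" "b = poly q y"
    using a b unfolding subring_gen_insert[OF D] by auto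
  have "pCons 0 p = [:z * z, 0, 1:] * q"
  proof (rule inj_onD[OF transcendental_over_inj[OF D y]])
    show "poly (pCons 0 p) y = poly ([:z * z, 0, 1:] * q) y"
      using eq by (simp add: p q algebra_simps)
    show "pCons 0 p \<in> polys_over D" using p D by (simp add: pCons_polys_over is_subring_0)
    show "[:z * z, 0, 1:] * q \<in> polys_over D"
      using q D z by (intro is_subring_mult is_subring_polys_over)
        (auto intro!: pCons_polys_over zero_polys_over is_subring_0 is_subring_1 is_subring_mult
          is_subring_polys_over)
  qed
  then have "poly (pCons 0 p) 0 = poly ([:z * z, 0, 1:] * q) 0" by simp
  then have "coeff q 0 = 0" using z by (simp add: poly_0_coeff_0)
  then obtain q' where q': "q = pCons 0 q'"
    by (metis coeff_pCons_0 pCons_cases)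
  then have "coeff q' i = coeff q (Suc i)" for i by simp
  then have "q' \<in> polys_over D" using q(1) by (simp add: polys_over_def)
  then have "poly q' y \<in> subring_gen (insert y D)" unfolding subring_gen_insert[OF D] by blast
  moreover have "a = (y * y + z * z) * poly q' y"
    using eq transcendental_over_nonzero[OF D y] by (simp add: q q')
  ultimately show ?thesis by blast
qed

text \<open>
  The cluster \<open>x, y, z\<close> and the Markov element enter only through algebraic independence and one
  relation. Both are symmetric in the coordinates, so a statement proved about the role of \<open>x\<close> transfers
  to \<open>y\<close> and \<open>z\<close> by interpreting the locale with permuted parameters.
\<close>

locale markov_coordinates =
  fixes x y z M :: "'a::field_char_0"
  assumes x_transcendental: "transcendental_over x (subring_gen {y, z})"
    and y_transcendental: "transcendental_over y (subring_gen {x, z})"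
    and z_transcendental: "transcendental_over z (subring_gen {x, y})"
    and relation: "M * x * y * z = x * x + y * y + z * z"
begin

abbreviation "markov_ring \<equiv> subring_gen {x, y, z, M}"

lemma swap_xy: "markov_coordinates y x z M"
  using x_transcendental y_transcendental z_transcendental relation
  by unfold_locales (simp_all add: insert_commute algebra_simps)

lemma swap_xz: "markov_coordinates z y x M"
  using x_transcendental y_transcendental z_transcendental relation
  by unfold_locales (simp_all add: insert_commute algebra_simps)

lemma nonzero: "x \<noteq> 0" "y \<noteq> 0" "z \<noteq> 0"
  using transcendental_over_nonzero[OF is_subring_gen] x_transcendental y_transcendental
    z_transcendental by blast+

lemma y_transcendental_z: "transcendental_over y (subring_gen {z})"
  by (rule transcendental_over_mono[OF y_transcendental], rule hull_mono) simp

lemma z_transcendental_empty: "transcendental_over z (subring_gen {})"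
  by (rule transcendental_over_mono[OF z_transcendental], rule hull_mono) simp

lemma z_transcendental_y: "transcendental_over z (subring_gen {y})"
  by (rule transcendental_over_mono[OF z_transcendental], rule hull_mono) simp

lemma sum_squares_nonzero: "y * y + z * z \<noteq> 0"
proof
  assume "y * y + z * z = 0"
  then have "poly [:z * z, 0, 1:] y = 0" by (simp add: add.commute)
  moreover have "[:z * z, 0, 1:] \<in> polys_over (subring_gen {z})"
    by (simp add: pCons_polys_over zero_polys_over is_subring_closed hull_inc)
  ultimately show False using transcendental_overD[OF y_transcendental_z] by fastforce
qed

abbreviation "base_ring \<equiv> subring_gen {y, z}"

lemma base_ring_mem: "y \<in> base_ring" "z \<in> base_ring" "y * z \<in> base_ring" "y * y + z * z \<in> base_ring"
  by (simp_all add: is_subring_closed hull_inc)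

lemma independent:
  assumes "u \<in> polys_over base_ring" "v \<in> polys_over base_ring" "poly u M + x * poly v M = 0"
  shows "u = 0 \<and> v = 0"
proof (rule markov_relation_independent[OF is_subring_gen x_transcendental _ _ _ _ _ assms])
  show "M * (x * (y * z)) = x * x + (y * y + z * z)" using relation by (simp add: algebra_simps)
qed (use base_ring_mem sum_squares_nonzero nonzero in auto)

lemma M_transcendental: "transcendental_over M base_ring"
  unfolding transcendental_over_def
  using independent[of _ 0] by (auto simp: zero_polys_over)

lemma x_quadratic: "x * x = (y * z * M) * x - (y * y + z * z)"
  using relation by (simp add: algebra_simps)

lemma M_ring_mem: "y * z * M \<in> subring_gen (insert M base_ring)"
    "y * y + z * z \<in> subring_gen (insert M base_ring)"
  using base_ring_mem by (simp_all add: is_subring_mult hull_inc)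

text \<open>
  The tower \<open>\<int> \<subseteq> \<int>[z] \<subseteq> \<int>[y, z] \<subseteq> \<int>[y, z, M] \<subseteq> \<int>[x, y, z, M]\<close>: each step but the last adjoins a
  transcendental element, and the last one is free of rank two with basis \<open>1, x\<close>.
\<close>

lemma markov_ring_tower: "markov_ring = subring_gen (insert x (subring_gen (insert M base_ring)))"
proof -
  have "markov_ring = subring_gen (insert x (insert M {y, z}))" by (simp add: insert_commute)
  then show ?thesis by (simp flip: hull_insert)
qed

lemma markov_ringE:
  assumes "f \<in> markov_ring"
  obtains u v where "u \<in> polys_over base_ring" "v \<in> polys_over base_ring" "f = poly u M + x * poly v M"
  using assms
  unfolding markov_ring_tower subring_gen_insert_quadratic[OF is_subring_gen M_ring_mem x_quadratic]
  by (auto simp: subring_gen_insert)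

lemma markov_ringI:
  assumes "u \<in> polys_over base_ring" "v \<in> polys_over base_ring"
  shows "poly u M + x * poly v M \<in> markov_ring"
  unfolding markov_ring_tower subring_gen_insert_quadratic[OF is_subring_gen M_ring_mem x_quadratic]
  using assms by (auto simp: subring_gen_insert)

text \<open>
  This expresses that the kernel of \<open>\<int>[X, Y, Z, W] \<rightarrow> \<int>[x, y, z, M]\<close> is generated by the Markov relation,
  in the only form in which it is used: every solution of the relation is the image of the generators
  under a homomorphism. It is obtained by climbing the tower one generator at a time.
\<close>

lemma ring_hom_exists:
  fixes a b c d :: "'b::comm_ring_1"
  assumes abcd: "d * a * b * c = a * a + b * b + c * c"
  obtains h where "ring_hom_on markov_ring h" "h x = a" "h y = b" "h z = c" "h M = d"
proof -
  obtain h0 :: "'a \<Rightarrow> 'b" where "ring_hom_on (subring_gen {}) h0"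
    by (rule ring_hom_on_integers)
  then obtain h1 :: "'a \<Rightarrow> 'b" where h1: "ring_hom_on (subring_gen {z}) h1" "h1 z = c"
    using ring_hom_on_extend_transcendental[OF is_subring_gen z_transcendental_empty, where \<tau> = c]
    by (metis hull_insert)
  then obtain h2 :: "'a \<Rightarrow> 'b" where h2: "ring_hom_on base_ring h2" "h2 y = b" "h2 z = c"
    using ring_hom_on_extend_transcendental[OF is_subring_gen y_transcendental_z, where \<tau> = b]
    by (metis hull_insert hull_inc singletonI)
  obtain h3 :: "'a \<Rightarrow> 'b" where h3: "ring_hom_on (subring_gen (insert M base_ring)) h3"
      "\<And>f. f \<in> base_ring \<Longrightarrow> h3 f = h2 f" "h3 M = d"
    using ring_hom_on_extend_transcendental[OF is_subring_gen M_transcendental h2(1), where \<tau> = d]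
    by blast
  have in3: "f \<in> base_ring \<Longrightarrow> f \<in> subring_gen (insert M base_ring)"
    "M \<in> subring_gen (insert M base_ring)" for f by (auto intro: hull_inc)
  have h3yz: "h3 y = b" "h3 z = c" using h3(2) h2 base_ring_mem by auto
  have hm: "h3 (y * z * M) = b * c * d" "h3 (y * y + z * z) = b * b + c * c"
    using in3 base_ring_mem
    by (simp_all add: ring_hom_on_mult[OF h3(1)] ring_hom_on_add[OF h3(1)] h3yz h3(3)
        is_subring_mult)
  have ind: "e = 0 \<and> f = 0"
    if "e \<in> subring_gen (insert M base_ring)" "f \<in> subring_gen (insert M base_ring)" "e + x * f = 0"
    for e f
    using that independent unfolding subring_gen_insert[OF is_subring_gen, of M] by fastforce
  have "a * a = h3 (y * z * M) * a - h3 (y * y + z * z)"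
    using abcd unfolding hm by (simp add: algebra_simps)
  then have "\<exists>h. ring_hom_on markov_ring h \<and>
      (\<forall>f\<in>subring_gen (insert M base_ring). h f = h3 f) \<and> h x = a"
    unfolding markov_ring_tower
    by (rule ring_hom_on_extend_quadratic[OF is_subring_gen M_ring_mem x_quadratic _ h3(1), rotated])
      (use ind in blast)+
  then obtain h where h: "ring_hom_on markov_ring h"
      "\<And>f. f \<in> subring_gen (insert M base_ring) \<Longrightarrow> h f = h3 f" "h x = a"
    by blast
  show thesis
    by (rule that[OF h(1,3)]) (use h(2) in3 base_ring_mem h3yz h3(3) in auto)
qed

text \<open>
  Divisibility by \<open>y\<^sup>2 + z\<^sup>2\<close> in \<open>\<int>[y, z][M]\<close> can be tested coefficient by coefficient.
\<close>

lemma dvd_sum_squares_polys: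
  assumes w: "w = y \<or> w = z" and u: "u \<in> polys_over base_ring"
    and v: "v \<in> polys_over base_ring" and eq: "smult w u = smult (y * y + z * z) v"
  shows "\<exists>c\<in>polys_over base_ring. u = smult (y * y + z * z) c"
proof -
  have yz: "base_ring = subring_gen (insert y (subring_gen {z}))"
    "base_ring = subring_gen (insert z (subring_gen {y}))"
    by (simp_all flip: hull_insert add: insert_commute)
  have coeff_u: "\<exists>c\<in>base_ring. coeff u i = (y * y + z * z) * c" for i
  proof -
    have e: "w * coeff u i = (y * y + z * z) * coeff v i"
      using arg_cong[OF eq, of "\<lambda>p. coeff p i"] by simp
    note mem = polys_over_coeff[OF u, of i] polys_over_coeff[OF v, of i]
    from w show ?thesis
    proof
      assume "w = y"
      then show ?thesis
        using dvd_sum_squares_cancel[OF is_subring_gen y_transcendental_z _ nonzero(3)] e mem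
        unfolding yz(1) by (auto intro: hull_inc)
    next
      assume "w = z"
      then show ?thesis
        using dvd_sum_squares_cancel[OF is_subring_gen z_transcendental_y _ nonzero(2)] e mem
        unfolding yz(2) by (auto intro: hull_inc simp: add.commute)
    qed
  qed
  have "smult (inverse (y * y + z * z)) u \<in> polys_over base_ring"
    unfolding polys_over_def mem_Collect_eq
  proof
    fix i
    obtain c where "c \<in> base_ring" "coeff u i = (y * y + z * z) * c"
      using coeff_u by blast
    then show "coeff (smult (inverse (y * y + z * z)) u) i \<in> base_ring"
      using sum_squares_nonzero by (simp flip: mult.assoc)
  qed
  moreover have "u = smult (y * y + z * z) (smult (inverse (y * y + z * z)) u)"
    using sum_squares_nonzero by simp
  ultimately show ?thesis by blast
qed

text \<open>
  Multiplication by \<open>x\<close> in the basis \<open>1, x\<close>. The first coordinate shows that \<open>u(M) + x v(M)\<close> can only be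
  a multiple of \<open>x\<close> if \<open>u\<close> is divisible by \<open>y\<^sup>2 + z\<^sup>2\<close>; \<open>x_dvdI\<close> is the converse.
\<close>

lemma x_times:
  "x * (poly u M + x * poly v M)
     = poly (smult (- (y * y + z * z)) v) M + x * poly (u + pCons 0 (smult (y * z) v)) M"
proof -
  have "x * (poly u M + x * poly v M) = x * poly u M + (x * x) * poly v M"
    by (simp add: algebra_simps)
  then show ?thesis unfolding x_quadratic by (simp add: algebra_simps)
qed

lemma coordinates_unique:
  assumes "u \<in> polys_over base_ring" "v \<in> polys_over base_ring"
    "u' \<in> polys_over base_ring" "v' \<in> polys_over base_ring"
    "poly u M + x * poly v M = poly u' M + x * poly v' M"
  shows "u = u'" "v = v'"
  using independent[of "u - u'" "v - v'"] assms
  by (auto simp: is_subring_diff is_subring_polys_over algebra_simps)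

lemma x_dvdI:
  assumes "c \<in> polys_over base_ring" "v \<in> polys_over base_ring"
  shows "\<exists>h\<in>markov_ring. poly (smult (y * y + z * z) c) M + x * poly v M = x * h"
proof
  let ?u = "v + pCons 0 (smult (y * z) c)"
  show "poly ?u M + x * poly (- c) M \<in> markov_ring"
    using assms base_ring_mem
    by (intro markov_ringI is_subring_add is_subring_minus pCons_polys_over smult_polys_over
        is_subring_polys_over) (auto simp: is_subring_0)
  show "poly (smult (y * y + z * z) c) M + x * poly v M = x * (poly ?u M + x * poly (- c) M)"
    by (simp only: x_times) (simp add: algebra_simps)
qed

text \<open>
  None of \<open>y\<close>, \<open>z\<close> and the mutated variable \<open>y z M - x\<close> is a zero divisor modulo \<open>x\<close>. The quotient by \<open>x\<close> is
  \<open>\<int>[y, z, M] / (y\<^sup>2 + z\<^sup>2)\<close>, where \<open>y z M - x\<close> becomes \<open>y z M\<close>. Concretely, in the basis \<open>1, x\<close> being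
  a multiple of \<open>x\<close> means that the first coordinate is divisible by \<open>y\<^sup>2 + z\<^sup>2\<close>, and factors \<open>y\<close>, \<open>z\<close> and
  \<open>M\<close> can be cancelled from such a divisibility.
\<close>

lemma x_cancel:
  assumes w: "w = y \<or> w = z \<or> w = y * z * M - x" and g: "g \<in> markov_ring" and h: "h \<in> markov_ring"
    and eq: "w * g = x * h"
  shows "\<exists>h'\<in>markov_ring. g = x * h'"
proof -
  let ?s = "y * y + z * z"
  obtain u v where uv: "u \<in> polys_over base_ring" "v \<in> polys_over base_ring"
      "g = poly u M + x * poly v M" using g by (rule markov_ringE)
  obtain u' v' where uv': "u' \<in> polys_over base_ring" "v' \<in> polys_over base_ring"
      "h = poly u' M + x * poly v' M" using h by (rule markov_ringE)
  note mem = base_ring_mem uv uv' is_subring_gen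
  have neg_s: "- (y * y) - z * z \<in> base_ring"
    using is_subring_minus[OF is_subring_gen base_ring_mem(4)] by simp
  have "\<exists>c\<in>polys_over base_ring. u = smult ?s c"
  proof (cases "w = y \<or> w = z")
    case True
    have "poly (smult w u) M + x * poly (smult w v) M
        = poly (smult (- ?s) v') M + x * poly (u' + pCons 0 (smult (y * z) v')) M"
      using eq unfolding uv uv' x_times[symmetric] by (simp add: algebra_simps)
    then have "smult w u = smult (- ?s) v'"
      by (rule coordinates_unique(1)[rotated 4])
         (use True mem neg_s in \<open>auto intro!: is_subring_add is_subring_polys_over pCons_polys_over
            smult_polys_over is_subring_0\<close>)
    then have "smult w u = smult ?s (- v')"
      by (simp only: smult_minus_left smult_minus_right)
    moreover have "- v' \<in> polys_over base_ring"
      using uv' by (simp add: is_subring_minus is_subring_polys_over)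
    ultimately show ?thesis
      using dvd_sum_squares_polys[OF True uv(1)] by simp
  next
    case False
    then have w: "w = y * z * M - x" using w by auto
    have "poly (pCons 0 (smult (y * z) u) + smult ?s v) M + x * poly (- u) M = w * g"
    proof -
      have "w * g = (y * z * M - x) * poly u M + ((y * z * M) * x - x * x) * poly v M"
        unfolding uv w by (simp add: algebra_simps)
      also have "(y * z * M) * x - x * x = ?s" using x_quadratic by simp
      finally show ?thesis by (simp add: algebra_simps)
    qed
    also have "\<dots> = poly (smult (- ?s) v') M + x * poly (u' + pCons 0 (smult (y * z) v')) M"
      unfolding eq uv' x_times ..
    finally have "pCons 0 (smult (y * z) u) + smult ?s v = smult (- ?s) v'"
      by (rule coordinates_unique(1)[rotated 4])
         (use mem neg_s in \<open>auto intro!: is_subring_add is_subring_minus is_subring_polys_over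
            pCons_polys_over smult_polys_over is_subring_0\<close>)
    then have e: "pCons 0 (smult (y * z) u) = smult ?s (- v' - v)"
      by (simp only: smult_diff_right smult_minus_left smult_minus_right eq_diff_eq)
    \<comment> \<open>cancel the factor \<open>M\<close> first, then \<open>y\<close> and \<open>z\<close>\<close>
    define t where "t = - v' - v"
    have t: "t \<in> polys_over base_ring"
      unfolding t_def using uv uv' by (auto intro!: is_subring_diff is_subring_minus is_subring_polys_over)
    have "coeff (smult ?s t) 0 = 0" using e by (metis coeff_pCons_0 t_def)
    then have "coeff t 0 = 0" using sum_squares_nonzero by simp
    then obtain t' where t': "t = pCons 0 t'" by (metis coeff_pCons_0 pCons_cases)
    then have "coeff t' i = coeff t (Suc i)" for i by simp
    then have t'': "t' \<in> polys_over base_ring" using t by (simp add: polys_over_def)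
    have "smult y (smult z u) = smult ?s t'"
      using e unfolding t_def[symmetric] t' by simp
    then obtain c where c: "c \<in> polys_over base_ring" "smult z u = smult ?s c"
      using dvd_sum_squares_polys[of y "smult z u" t'] t'' uv base_ring_mem
      by (auto simp: smult_polys_over)
    then show ?thesis using dvd_sum_squares_polys[of z u c] uv by simp
  qed
  then obtain c where "c \<in> polys_over base_ring" "u = smult ?s c" by blast
  then show ?thesis using x_dvdI[of c v] uv by simp
qed

text \<open>
  An element whose denominator is a power of \<open>x\<close>, and which also becomes integral after multiplication
  by some \<open>W\<close> that is not a zero divisor modulo \<open>x\<close>, was integral already: the numerator times \<open>W\<close> is
  divisible by that power of \<open>x\<close>, so the numerator is, one factor \<open>x\<close> at a time.
\<close>

lemma x_denominator_cancel:
  assumes W: "W = (y * z * M - x) ^ i * y ^ j * z ^ k" and Wf: "W * f \<in> markov_ring"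
    and xf: "x ^ n * f \<in> markov_ring"
  shows "f \<in> markov_ring"
proof -
  have mem: "x \<in> markov_ring" "y \<in> markov_ring" "z \<in> markov_ring" "y * z * M - x \<in> markov_ring"
    by (simp_all add: is_subring_diff is_subring_mult hull_inc)
  have pow: "\<exists>h'\<in>markov_ring. g = x * h'"
    if "w = y \<or> w = z \<or> w = y * z * M - x" "g \<in> markov_ring" "h \<in> markov_ring" "w ^ m * g = x * h"
    for w g h m
    using that(2-4)
  proof (induction m arbitrary: g h)
    case (Suc m)
    have "w * (w ^ m * g) = x * h" using Suc.prems by (simp add: mult_ac)
    moreover have "w ^ m * g \<in> markov_ring"
      using that(1) Suc.prems mem by (auto simp add: is_subring_mult is_subring_power)
    ultimately show ?case using x_cancel[OF that(1)] Suc by metis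
  qed auto
  have Wcancel: "\<exists>h'\<in>markov_ring. g = x * h'"
    if g: "g \<in> markov_ring" and h: "h \<in> markov_ring" and eq: "W * g = x * h" for g h
  proof -
    have g1: "z ^ k * g \<in> markov_ring" and g2: "y ^ j * (z ^ k * g) \<in> markov_ring"
      using g mem by (simp_all add: is_subring_mult is_subring_power)
    have "(y * z * M - x) ^ i * (y ^ j * (z ^ k * g)) = x * h"
      using eq W by (simp add: mult_ac)
    then obtain h2 where "h2 \<in> markov_ring" "y ^ j * (z ^ k * g) = x * h2"
      using pow[of "y * z * M - x"] g2 h by metis
    then obtain h3 where "h3 \<in> markov_ring" "z ^ k * g = x * h3"
      using pow[of y] g1 by metis
    then show ?thesis using pow[of z] g by metis
  qed
  show ?thesis using xf
  proof (induction n)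
    case (Suc n)
    have "x ^ n * (W * f) \<in> markov_ring"
      using Wf mem by (simp add: is_subring_mult is_subring_power)
    moreover have "W * (x ^ Suc n * f) = x * (x ^ n * (W * f))" by (simp add: mult_ac)
    ultimately obtain h where "h \<in> markov_ring" "x ^ Suc n * f = x * h"
      using Wcancel Suc.prems by blast
    then show ?case using Suc.IH nonzero(1) by (simp add: mult.assoc)
  qed auto
qed

text \<open>
  Four clusters are enough to bound the upper cluster algebra from above. The denominator in the initial
  cluster is \<open>(x y z)\<^sup>k\<close>; the mutation at each variable removes that variable from it.
\<close>

lemma markov_ring_mem_if_bounded_denominators:
  assumes "(x * y * z) ^ k * f \<in> markov_ring"
    and "((y * z * M - x) * y * z) ^ l * f \<in> markov_ring"
    and "(x * (x * z * M - y) * z) ^ m * f \<in> markov_ring"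
    and "(x * y * (x * y * M - z)) ^ n * f \<in> markov_ring"
  shows "f \<in> markov_ring"
proof -
  interpret Y: markov_coordinates y x z M by (rule swap_xy)
  interpret Z: markov_coordinates z y x M by (rule swap_xz)
  have sets: "Y.markov_ring = markov_ring" "Z.markov_ring = markov_ring"
    by (simp_all add: insert_commute)
  have mem: "y ^ k \<in> markov_ring" "z ^ k \<in> markov_ring"
    by (simp_all add: is_subring_power hull_inc)
  have "y ^ k * z ^ k * f \<in> markov_ring"
  proof (rule x_denominator_cancel[OF refl])
    have "y ^ k * z ^ k * (((y * z * M - x) * y * z) ^ l * f) \<in> markov_ring"
      using is_subring_mult[OF is_subring_gen is_subring_mult[OF is_subring_gen mem] assms(2)] .
    then show "(y * z * M - x) ^ l * y ^ l * z ^ l * (y ^ k * z ^ k * f) \<in> markov_ring"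
      by (simp add: power_mult_distrib mult_ac)
    show "x ^ k * (y ^ k * z ^ k * f) \<in> markov_ring"
      using assms(1) by (simp add: power_mult_distrib mult_ac)
  qed
  then have "y ^ k * (z ^ k * f) \<in> markov_ring" by (simp add: mult_ac)
  moreover have "z ^ k * ((x * (x * z * M - y) * z) ^ m * f) \<in> markov_ring"
    using is_subring_mult[OF is_subring_gen mem(2) assms(3)] .
  then have "(x * z * M - y) ^ m * x ^ m * z ^ m * (z ^ k * f) \<in> markov_ring"
    by (simp add: power_mult_distrib mult_ac)
  ultimately have "z ^ k * f \<in> markov_ring"
    using Y.x_denominator_cancel[OF refl, of m m m "z ^ k * f" k] unfolding sets by simp
  moreover have "(y * x * M - z) ^ n * y ^ n * x ^ n * f \<in> markov_ring"
    using assms(4) by (simp add: power_mult_distrib mult_ac)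
  ultimately show ?thesis
    using Z.x_denominator_cancel[OF refl, of n n n f k] unfolding sets by simp
qed

end

section \<open>Algebraic independence of the initial cluster\<close>

text \<open>
  In an extension of a polynomial ring the indeterminate is transcendental over the constants, since
  evaluating \<open>\<Sum>\<^sub>i \<iota>(c\<^sub>i) T\<^sup>i\<close> at \<open>T = \<iota>(X)\<close> gives \<open>\<iota>(\<Sum>\<^sub>i c\<^sub>i X\<^sup>i)\<close>. It is used for the three nested
  polynomial rings from which \<open>\<rat>(x, y, z)\<close> is formed.
\<close>

lemma transcendental_over_range:
  fixes \<iota> :: "'c::comm_ring_1 poly \<Rightarrow> 'a::comm_ring_1"
  assumes add: "\<And>p q. \<iota> (p + q) = \<iota> p + \<iota> q" and mult: "\<And>p q. \<iota> (p * q) = \<iota> p * \<iota> q"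
    and inj: "\<And>p. \<iota> p = 0 \<Longrightarrow> p = 0"
  shows "transcendental_over (\<iota> [:0, 1:]) (range (\<lambda>c. \<iota> [:c:]))"
  unfolding transcendental_over_def
proof (intro ballI impI)
  fix p assume p: "p \<in> polys_over (range (\<lambda>c. \<iota> [:c:]))" and root: "poly p (\<iota> [:0, 1:]) = 0"
  have zero: "\<iota> 0 = 0" using add[of 0 0] by simp
  have "\<exists>q. p = map_poly (\<lambda>c. \<iota> [:c:]) q \<and> poly p (\<iota> [:0, 1:]) = \<iota> q"
    using p
  proof (induction p)
    case 0
    show ?case by (intro exI[of _ 0]) (simp add: zero)
  next
    case (pCons a p)
    have "p \<in> polys_over (range (\<lambda>c. \<iota> [:c:]))"
      unfolding polys_over_def[of "range _"] mem_Collect_eq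
    proof
      fix i
      show "coeff p i \<in> range (\<lambda>c. \<iota> [:c:])"
        using polys_over_coeff[OF pCons.prems, of "Suc i"] by (simp only: coeff_pCons_Suc)
    qed
    from pCons.IH[OF this] obtain q
      where q: "p = map_poly (\<lambda>c. \<iota> [:c:]) q" "poly p (\<iota> [:0, 1:]) = \<iota> q" by auto
    have "a \<in> range (\<lambda>c. \<iota> [:c:])"
      using polys_over_coeff[OF pCons.prems, of 0] by (simp only: coeff_pCons_0)
    then obtain c where c: "a = \<iota> [:c:]" by (rule rangeE)
    have "pCons c q = [:c:] + [:0, 1:] * q" by simp
    then have "\<iota> (pCons c q) = a + \<iota> [:0, 1:] * \<iota> q" by (simp only: add mult c)
    then have "poly (pCons a p) (\<iota> [:0, 1:]) = \<iota> (pCons c q)" by (simp only: poly_pCons q(2))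
    moreover have "pCons a p = map_poly (\<lambda>c. \<iota> [:c:]) (pCons c q)"
      using map_poly_pCons[of "\<lambda>c. \<iota> [:c:]" c q] c q(1) zero by (simp only: pCons_0_0)
    ultimately show ?case by (intro exI[of _ "pCons c q"] conjI)
  qed
  then obtain q where q: "p = map_poly (\<lambda>c. \<iota> [:c:]) q" "poly p (\<iota> [:0, 1:]) = \<iota> q"
    by (elim exE conjE)
  have "q = 0" using q(2) unfolding root by (intro inj) (rule sym)
  then show "p = 0" unfolding q(1) by simp
qed

lemma is_subring_range_hom:
  fixes \<iota> :: "'c::comm_ring_1 \<Rightarrow> 'a::comm_ring_1"
  assumes "\<And>p q. \<iota> (p + q) = \<iota> p + \<iota> q" "\<And>p q. \<iota> (p * q) = \<iota> p * \<iota> q" "\<iota> 1 = 1"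
  shows "is_subring (range \<iota>)"
proof -
  have "\<iota> p - \<iota> q = \<iota> (p - q)" for p q using assms(1)[of "p - q" q] by simp
  moreover have "\<iota> p * \<iota> q = \<iota> (p * q)" for p q using assms(2) by simp
  moreover have "1 \<in> range \<iota>" by (rule range_eqI[of _ _ 1]) (simp add: assms(3))
  ultimately show ?thesis unfolding is_subring_def by blast
qed

lemma Fract_1_eq_0_iff: "Fract p 1 = 0 \<longleftrightarrow> p = 0"
  by (simp add: Zero_fract_def eq_fract)

text \<open>
  Embeddings of the coefficient rings of the three nested polynomial rings into \<open>\<rat>(x, y, z)\<close>. Their
  ranges contain the subrings generated by \<open>x, y\<close>, by \<open>x\<close> and by no variable at all.
\<close>

lemma Fract_constant_hom:
  "Fract [:p + q:] 1 = Fract [:p:] 1 + Fract [:q:] 1"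
  "Fract [:p * q:] 1 = Fract [:p:] 1 * Fract [:q:] 1"
  "Fract [:1:] 1 = 1"
  for p q :: "'a::idom"
  by (simp_all add: mult.commute One_fract_def flip: one_pCons)

lemma Fract_constant2_hom:
  "Fract [:[:p + q:]:] 1 = Fract [:[:p:]:] 1 + Fract [:[:q:]:] 1"
  "Fract [:[:p * q:]:] 1 = Fract [:[:p:]:] 1 * Fract [:[:q:]:] 1"
  "Fract [:[:1:]:] 1 = 1"
  for p q :: "'a::idom"
  by (simp_all add: mult.commute One_fract_def flip: one_pCons)

lemma Fract_constant3_hom:
  "Fract [:[:[:p + q:]:]:] 1 = Fract [:[:[:p:]:]:] 1 + Fract [:[:[:q:]:]:] 1"
  "Fract [:[:[:p * q:]:]:] 1 = Fract [:[:[:p:]:]:] 1 * Fract [:[:[:q:]:]:] 1"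
  "Fract [:[:[:1:]:]:] 1 = 1"
  for p q :: "'a::idom"
  by (simp_all add: mult.commute One_fract_def flip: one_pCons)

lemma initial_transcendental:
  "transcendental_over var_x (subring_gen {})"
  "transcendental_over var_y (subring_gen {var_x})"
  "transcendental_over var_z (subring_gen {var_x, var_y})"
proof -
  have x: "transcendental_over var_x (range (\<lambda>c. Fract [:[:[:c:]:]:] 1))"
    unfolding var_x_def
    by (rule transcendental_over_range[OF Fract_constant2_hom(1,2)]) (simp add: Fract_1_eq_0_iff)
  have y: "transcendental_over var_y (range (\<lambda>c. Fract [:[:c:]:] 1))"
    unfolding var_y_def
    by (rule transcendental_over_range[OF Fract_constant_hom(1,2)]) (simp add: Fract_1_eq_0_iff)
  have z: "transcendental_over var_z (range (\<lambda>c. Fract [:c:] 1))"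
    unfolding var_z_def
    by (rule transcendental_over_range[where \<iota> = "\<lambda>p. Fract p 1"]) (simp_all add: Fract_1_eq_0_iff)
  have "is_subring (range (\<lambda>c. Fract [:[:[:c:]:]:] 1 :: ratfun))"
    by (rule is_subring_range_hom[OF Fract_constant3_hom])
  then show "transcendental_over var_x (subring_gen {})"
    by (intro transcendental_over_mono[OF x] hull_minimal) auto
  have "is_subring (range (\<lambda>c. Fract [:[:c:]:] 1 :: ratfun))"
    by (rule is_subring_range_hom[OF Fract_constant2_hom])
  then show "transcendental_over var_y (subring_gen {var_x})"
    by (intro transcendental_over_mono[OF y] hull_minimal) (auto simp: var_x_def)
  have "is_subring (range (\<lambda>c. Fract [:c:] 1 :: ratfun))"
    by (rule is_subring_range_hom[OF Fract_constant_hom])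
  then show "transcendental_over var_z (subring_gen {var_x, var_y})"
    by (intro transcendental_over_mono[OF z] hull_minimal) (auto simp: var_x_def var_y_def)
qed

lemma subring_gen_insert_gen: "subring_gen (insert a (subring_gen S)) = subring_gen (insert a S)"
  by (rule hull_insert[symmetric])

text \<open>
  The fraction field of an iterated polynomial ring over \<open>\<rat>\<close> is an ordered field. As the initial
  variables are positive and the exchange relations are subtraction free, all cluster variables are
  positive, which is how their non-vanishing is obtained.
\<close>

lemma initial_positive: "var_x > 0" "var_y > 0" "var_z > 0"
  by (auto simp: var_x_def var_y_def var_z_def zero_less_Fract_iff less_poly_def pos_poly_def)

interpretation markov_coordinates var_x var_y var_z markov_element
proof
  note exch = transcendental_over_exchange[OF is_subring_gen, unfolded subring_gen_insert_gen]
  show "transcendental_over var_z (subring_gen {var_x, var_y})"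
    by (fact initial_transcendental(3))
  have z: "transcendental_over var_z (subring_gen {var_y, var_x})"
    using initial_transcendental(3) by (simp add: insert_commute)
  then show "transcendental_over var_y (subring_gen {var_x, var_z})"
    using exch[OF initial_transcendental(2)] by (simp add: insert_commute[of var_x])
  have "transcendental_over var_x (subring_gen {var_y})"
    using exch[OF initial_transcendental(1,2)] .
  then show "transcendental_over var_x (subring_gen {var_y, var_z})"
    using exch[OF _ initial_transcendental(3)] by (simp add: insert_commute)
  show "markov_element * var_x * var_y * var_z = var_x * var_x + var_y * var_y + var_z * var_z"
    using initial_positive by (simp add: markov_element_def power2_eq_square)
qed

section \<open>The upper cluster algebra is generated by the initial cluster and the Markov element\<close>

lemma markov_mutation:
  fixes a b c M :: "'a::field"
  assumes "M * a * b * c = a^2 + b^2 + c^2" "a \<noteq> 0"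
  shows "(b^2 + c^2) / a = b * c * M - a"
  using assms by (simp add: field_simps power2_eq_square)

lemma subring_gen_mutation:
  "subring_gen (insert (r - a) S) = subring_gen (insert a S)" if "r \<in> subring_gen S"
proof -
  have *: "subring_gen (insert (r - a) S) \<subseteq> subring_gen (insert a S)" for a
  proof (rule hull_minimal)
    have "r \<in> subring_gen (insert a S)" using that hull_mono[of S "insert a S"] by blast
    then show "insert (r - a) S \<subseteq> subring_gen (insert a S)"
      by (auto intro!: is_subring_diff intro: hull_inc)
  qed simp
  from *[of a] *[of "r - a"] show ?thesis by auto
qed

text \<open>
  The Markov relation holds with the same \<open>M\<close> at every cluster, so a mutation replaces \<open>a\<close> by
  \<open>b c M - a\<close>. This is a change of generators of the same ring: each cluster, together with \<open>M\<close>,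
  generates the ring of the initial one.
\<close>

lemma markov_cluster_ring:
  assumes "markov_cluster a b c"
  shows "a > 0 \<and> b > 0 \<and> c > 0 \<and> markov_element * a * b * c = a^2 + b^2 + c^2
    \<and> subring_gen {a, b, c, markov_element} = markov_ring"
  using assms
proof (induction rule: markov_cluster.induct)
  case initial
  show ?case using initial_positive relation by (simp add: power2_eq_square)
next
  case (mutate_1 a b c)
  have mut: "(b^2 + c^2) / a = b * c * markov_element - a"
    using mutate_1.IH by (intro markov_mutation) auto
  have "b * c * markov_element \<in> subring_gen {b, c, markov_element}"
    by (simp add: is_subring_mult hull_inc)
  from subring_gen_mutation[OF this, of a]
  have "subring_gen {(b^2 + c^2) / a, b, c, markov_element} = markov_ring"
    using mutate_1.IH by (simp add: mut)
  moreover have "markov_element * a * b * c = a^2 + b^2 + c^2" using mutate_1.IH by blast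
  then have "markov_element * ((b^2 + c^2) / a) * b * c = ((b^2 + c^2) / a)^2 + b^2 + c^2"
    unfolding mut by algebra
  ultimately show ?case using mutate_1.IH by (simp add: add_pos_pos)
next
  case (mutate_2 a b c)
  have "markov_element * b * a * c = b^2 + a^2 + c^2" using mutate_2.IH by (simp add: mult_ac add_ac)
  then have mut: "(a^2 + c^2) / b = a * c * markov_element - b"
    using mutate_2.IH by (intro markov_mutation) auto
  have "a * c * markov_element \<in> subring_gen {a, c, markov_element}"
    by (simp add: is_subring_mult hull_inc)
  from subring_gen_mutation[OF this, of b]
  have "subring_gen {a, (a^2 + c^2) / b, c, markov_element} = markov_ring"
    using mutate_2.IH by (simp add: mut insert_commute)
  moreover have "markov_element * a * b * c = a^2 + b^2 + c^2" using mutate_2.IH by blast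
  then have "markov_element * a * ((a^2 + c^2) / b) * c = a^2 + ((a^2 + c^2) / b)^2 + c^2"
    unfolding mut by algebra
  ultimately show ?case using mutate_2.IH by (simp add: add_pos_pos)
next
  case (mutate_3 a b c)
  have "markov_element * c * a * b = c^2 + a^2 + b^2" using mutate_3.IH by (simp add: mult_ac add_ac)
  then have mut: "(a^2 + b^2) / c = a * b * markov_element - c"
    using mutate_3.IH by (intro markov_mutation) auto
  have "a * b * markov_element \<in> subring_gen {a, b, markov_element}"
    by (simp add: is_subring_mult hull_inc)
  from subring_gen_mutation[OF this, of c]
  have "subring_gen {a, b, (a^2 + b^2) / c, markov_element} = markov_ring"
    using mutate_3.IH by (simp add: mut insert_commute)
  moreover have "markov_element * a * b * c = a^2 + b^2 + c^2" using mutate_3.IH by blast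
  then have "markov_element * a * b * ((a^2 + b^2) / c) = a^2 + b^2 + ((a^2 + b^2) / c)^2"
    unfolding mut by algebra
  ultimately show ?case using mutate_3.IH by (simp add: add_pos_pos)
qed

lemma markov_cluster_mem:
  assumes "markov_cluster a b c"
  shows "a \<in> markov_ring" "b \<in> markov_ring" "c \<in> markov_ring"
proof -
  have "subring_gen {a, b, c, markov_element} = markov_ring" using markov_cluster_ring[OF assms] by blast
  then show "a \<in> markov_ring" "b \<in> markov_ring" "c \<in> markov_ring"
    by (auto intro: hull_inc simp flip: \<open>_ = markov_ring\<close>)
qed

lemma laurent_monomial:
  "of_int n * a powi i * b powi j * c powi k \<in> laurent_ring a b c"
  unfolding laurent_ring_def
  by (auto intro!: exI[of _ "{(i, j, k)}"] exI[of _ "\<lambda>_ _ _. n"])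

lemma laurent_ring_add:
  assumes "f \<in> laurent_ring a b c" "g \<in> laurent_ring a b c"
  shows "f + g \<in> laurent_ring a b c"
proof -
  let ?m = "\<lambda>(u :: int \<Rightarrow> int \<Rightarrow> int \<Rightarrow> int) (i, j, k). of_int (u i j k) * a powi i * b powi j * c powi k"
  obtain S u where S: "finite S" "f = sum (?m u) S" using assms(1) unfolding laurent_ring_def by auto
  obtain T v where T: "finite T" "g = sum (?m v) T" using assms(2) unfolding laurent_ring_def by auto
  define w where "w i j k = (if (i, j, k) \<in> S then u i j k else 0) + (if (i, j, k) \<in> T then v i j k else 0)"
    for i j k
  have "sum (?m w) (S \<union> T)
      = (\<Sum>x\<in>S \<union> T. (if x \<in> S then ?m u x else 0) + (if x \<in> T then ?m v x else 0))"
    by (intro sum.cong) (auto simp: w_def algebra_simps)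
  also have "\<dots> = f + g"
    using S T by (simp add: sum.distrib sum.If_cases Int_absorb1 Int_Collect flip: Int_def)
  finally have "f + g = sum (?m w) (S \<union> T)" ..
  then show ?thesis unfolding laurent_ring_def using S(1) T(1) by blast
qed

lemma laurent_ring_sum:
  "(\<And>i. i \<in> S \<Longrightarrow> f i \<in> laurent_ring a b c) \<Longrightarrow> sum f S \<in> laurent_ring a b c"
proof (induction S rule: infinite_finite_induct)
  case (insert i S)
  then show ?case by (simp add: laurent_ring_add)
qed (use laurent_monomial[of 0 a 0 b 0 c 0] in auto)

lemma is_subring_laurent_ring:
  assumes nz: "a \<noteq> 0" "b \<noteq> 0" "c \<noteq> 0"
  shows "is_subring (laurent_ring a b c)"
  unfolding is_subring_def
proof (intro conjI ballI)
  let ?m = "\<lambda>(u :: int \<Rightarrow> int \<Rightarrow> int \<Rightarrow> int) (i, j, k). of_int (u i j k) * a powi i * b powi j * c powi k"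
  show "1 \<in> laurent_ring a b c" using laurent_monomial[of 1 a 0 b 0 c 0] by simp
  fix f g assume fg: "f \<in> laurent_ring a b c" "g \<in> laurent_ring a b c"
  have mult: "f * g \<in> laurent_ring a b c"
    if f: "f \<in> laurent_ring a b c" and g: "g \<in> laurent_ring a b c" for f g
  proof -
    obtain S u where S: "f = sum (?m u) S" using f unfolding laurent_ring_def by auto
    obtain T v where T: "g = sum (?m v) T" using g unfolding laurent_ring_def by auto
    have "?m u s * ?m v t \<in> laurent_ring a b c" for s t
    proof -
      obtain i j k i' j' k' where "s = (i, j, k)" "t = (i', j', k')" by (metis prod_cases3)
      then have "?m u s * ?m v t
          = of_int (u i j k * v i' j' k') * a powi (i + i') * b powi (j + j') * c powi (k + k')"
        using nz by (simp add: power_int_add)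
      then show ?thesis using laurent_monomial by metis
    qed
    then show ?thesis unfolding S T sum_product by (intro laurent_ring_sum)
  qed
  then show "f * g \<in> laurent_ring a b c" using fg .
  have "of_int (-1) * a powi 0 * b powi 0 * c powi 0 * g \<in> laurent_ring a b c"
    using mult[OF laurent_monomial fg(2)] .
  then show "f - g \<in> laurent_ring a b c" using laurent_ring_add[OF fg(1)] by fastforce
qed


text \<open>
  Elements that become members of \<open>R\<close> after multiplication by a power of \<open>a b c\<close> are closed under
  addition and include all Laurent monomials.
\<close>

lemma laurent_ring_clear_denominators:
  assumes R: "is_subring R" and mem: "a \<in> R" "b \<in> R" "c \<in> R"
    and nz: "a \<noteq> 0" "b \<noteq> 0" "c \<noteq> 0" and f: "f \<in> laurent_ring a b c"
  shows "\<exists>N. (a * b * c) ^ N * f \<in> R"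
proof -
  let ?D = "{f. \<exists>N. (a * b * c) ^ N * f \<in> R}"
  have mon: "of_int n * a powi i * b powi j * c powi k \<in> ?D" for n i j k
  proof -
    define N where "N = nat \<bar>i\<bar> + nat \<bar>j\<bar> + nat \<bar>k\<bar>"
    have pow: "e ^ N * e powi l = e ^ nat (int N + l)" if "e \<noteq> 0" "\<bar>l\<bar> \<le> int N" for e :: ratfun and l
    proof -
      have "e ^ N * e powi l = e powi (int N + l)" using that(1) by (simp add: power_int_add)
      also have "\<dots> = e ^ nat (int N + l)" using that(2) by (simp add: power_int_def)
      finally show ?thesis .
    qed
    have "(a * b * c) ^ N * (of_int n * a powi i * b powi j * c powi k)
        = of_int n * (a ^ N * a powi i) * (b ^ N * b powi j) * (c ^ N * c powi k)"
      by (simp add: power_mult_distrib mult_ac)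
    also have "\<dots> = of_int n * a ^ nat (int N + i) * b ^ nat (int N + j) * c ^ nat (int N + k)"
    proof -
      have "\<bar>i\<bar> \<le> int N" "\<bar>j\<bar> \<le> int N" "\<bar>k\<bar> \<le> int N" by (simp_all add: N_def)
      then show ?thesis by (simp only: pow[OF nz(1)] pow[OF nz(2)] pow[OF nz(3)])
    qed
    also have "\<dots> \<in> R"
      using R mem by (simp add: is_subring_closed)
    finally show ?thesis by blast
  qed
  have add: "f + g \<in> ?D" if "f \<in> ?D" "g \<in> ?D" for f g
  proof -
    from that obtain m n where mn: "(a * b * c) ^ m * f \<in> R" "(a * b * c) ^ n * g \<in> R" by blast
    have "(a * b * c) ^ (m + n) * (f + g)
        = (a * b * c) ^ n * ((a * b * c) ^ m * f) + (a * b * c) ^ m * ((a * b * c) ^ n * g)"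
      by (simp add: power_add algebra_simps)
    also have "\<dots> \<in> R"
      using R mem mn by (simp add: is_subring_add is_subring_mult is_subring_power)
    finally show ?thesis by blast
  qed
  obtain S and u :: "int \<Rightarrow> int \<Rightarrow> int \<Rightarrow> int" where "finite S"
    and f: "f = (\<Sum>(i, j, k)\<in>S. of_int (u i j k) * a powi i * b powi j * c powi k)"
    using f unfolding laurent_ring_def by auto
  from \<open>finite S\<close> have "(\<Sum>(i, j, k)\<in>S. of_int (u i j k) * a powi i * b powi j * c powi k) \<in> ?D"
  proof induction
    case empty
    then show ?case using is_subring_0[OF R] by simp
  next
    case (insert s S)
    obtain i j k where s: "s = (i, j, k)" by (metis prod_cases3)
    show ?case
      using add[OF mon insert.IH] insert.hyps unfolding s by simp
  qed
  then show ?thesis unfolding f by blast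
qed

text \<open>
  The theorem of Matherne and Muller. One inclusion holds because \<open>M\<close> and the cluster variables of any
  cluster are Laurent in that cluster and generate the same ring; the other uses the initial cluster and
  its three neighbours.
\<close>

lemma markov_upper_eq: "markov_upper = markov_ring"
proof
  show "markov_ring \<subseteq> markov_upper"
    unfolding markov_upper_def
  proof (intro subsetI CollectI allI impI)
    fix f a b c assume f: "f \<in> markov_ring" and "markov_cluster a b c"
    then have cl: "a > 0" "b > 0" "c > 0" "markov_element * a * b * c = a^2 + b^2 + c^2"
      "subring_gen {a, b, c, markov_element} = markov_ring"
      using markov_cluster_ring by blast+
    have L: "is_subring (laurent_ring a b c)" using cl by (intro is_subring_laurent_ring) auto
    have "a \<in> laurent_ring a b c" "b \<in> laurent_ring a b c" "c \<in> laurent_ring a b c"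
      using laurent_monomial[of 1 a 1 b 0 c 0] laurent_monomial[of 1 a 0 b 1 c 0]
        laurent_monomial[of 1 a 0 b 0 c 1] by simp_all
    moreover have "markov_element = of_int 1 * a powi 1 * b powi (-1) * c powi (-1)
        + of_int 1 * a powi (-1) * b powi 1 * c powi (-1)
        + of_int 1 * a powi (-1) * b powi (-1) * c powi 1"
      using cl by (simp add: field_simps power2_eq_square)
    then have "markov_element \<in> laurent_ring a b c"
      by (metis laurent_monomial laurent_ring_add)
    ultimately have "subring_gen {a, b, c, markov_element} \<subseteq> laurent_ring a b c"
      using L by (intro hull_minimal) auto
    then show "f \<in> laurent_ring a b c" using f cl(5) by blast
  qed
  show "markov_upper \<subseteq> markov_ring"
  proof
    fix f assume f: "f \<in> markov_upper"
    have clear: "\<exists>N. (a * b * c) ^ N * f \<in> markov_ring" if cl: "markov_cluster a b c" for a b c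
    proof (rule laurent_ring_clear_denominators)
      show "f \<in> laurent_ring a b c" using f that by (auto simp: markov_upper_def)
    qed (use markov_cluster_ring[OF cl] markov_cluster_mem[OF cl] in auto)
    note init = markov_cluster.initial
    note rel = relation[folded power2_eq_square]
    have "(var_y^2 + var_z^2) / var_x = var_y * var_z * markov_element - var_x"
      "(var_x^2 + var_z^2) / var_y = var_x * var_z * markov_element - var_y"
      "(var_x^2 + var_y^2) / var_z = var_x * var_y * markov_element - var_z"
      using rel nonzero by (simp_all add: field_simps power2_eq_square)
    then show "f \<in> markov_ring"
      using clear[OF init] clear[OF mutate_1[OF init]] clear[OF mutate_2[OF init]]
        clear[OF mutate_3[OF init]] markov_ring_mem_if_bounded_denominators by metis
  qed
qed

section \<open>Deep points\<close>

lemma points_iff: "p \<in> points \<longleftrightarrow> p \<in> extensional markov_ring \<and> ring_hom_on markov_ring p"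
  by (simp add: points_def ring_hom_on_def markov_upper_eq)

lemma generators_mem: "var_x \<in> markov_ring" "var_y \<in> markov_ring" "var_z \<in> markov_ring"
    "markov_element \<in> markov_ring"
  by (auto intro: hull_inc)

lemma point_exists:
  fixes a b c d :: "'k::field"
  assumes "d * a * b * c = a^2 + b^2 + c^2"
  shows "\<exists>p\<in>points. coords p = (a, b, c, d)"
proof -
  obtain h where h: "ring_hom_on markov_ring h" "h var_x = a" "h var_y = b" "h var_z = c"
      "h markov_element = d"
    using ring_hom_exists[of d a b c] assms unfolding power2_eq_square by metis
  have "ring_hom_on markov_ring (restrict h markov_ring)"
    using h(1) by (simp add: ring_hom_on_def is_subring_closed)
  then have "restrict h markov_ring \<in> points" by (simp add: points_iff)
  then show ?thesis
    using h generators_mem by (intro bexI[of _ "restrict h markov_ring"]) (simp_all add: coords_def)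
qed

lemma point_unique:
  assumes p: "p \<in> points" and q: "q \<in> points" and eq: "coords p = coords q"
  shows "p = q"
proof (rule extensionalityI)
  show "p \<in> extensional markov_ring" "q \<in> extensional markov_ring"
    using p q by (simp_all add: points_iff)
  fix f assume "f \<in> markov_ring"
  then show "p f = q f"
    using p q eq
    by (elim ring_hom_on_eqI[rotated 3]) (auto simp: points_iff coords_def)
qed

text \<open>
  On a point, mutation is the polynomial map \<open>a \<mapsto> b c M - a\<close>, which makes sense even where the
  denominator of the exchange relation vanishes.
\<close>

lemma point_mutation:
  fixes p :: "ratfun \<Rightarrow> 'k::field"
  assumes p: "p \<in> points" and cl: "markov_cluster a b c"
  shows "p ((b^2 + c^2) / a) = p b * p c * p markov_element - p a"
    and "p ((a^2 + c^2) / b) = p a * p c * p markov_element - p b"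
    and "p ((a^2 + b^2) / c) = p a * p b * p markov_element - p c"
proof -
  have hom: "ring_hom_on markov_ring p" using p by (simp add: points_iff)
  note mem = markov_cluster_mem[OF cl] generators_mem
  have exchange: "p (f * g * markov_element - e) = p f * p g * p markov_element - p e"
    if "e \<in> markov_ring" "f \<in> markov_ring" "g \<in> markov_ring" for e f g
    using that mem by (simp add: ring_hom_on_diff[OF is_subring_gen hom] ring_hom_on_mult[OF hom]
        is_subring_mult)
  have "(b^2 + c^2) / a = b * c * markov_element - a" "(a^2 + c^2) / b = a * c * markov_element - b"
    "(a^2 + b^2) / c = a * b * markov_element - c"
    using markov_cluster_ring[OF cl] by (auto simp: field_simps power2_eq_square)
  then show "p ((b^2 + c^2) / a) = p b * p c * p markov_element - p a"
    "p ((a^2 + c^2) / b) = p a * p c * p markov_element - p b"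
    "p ((a^2 + b^2) / c) = p a * p b * p markov_element - p c"
    using exchange mem by simp_all
qed

lemma point_relation:
  fixes p :: "ratfun \<Rightarrow> 'k::field"
  assumes p: "p \<in> points"
  shows "p markov_element * p var_x * p var_y * p var_z = (p var_x)^2 + (p var_y)^2 + (p var_z)^2"
proof -
  have hom: "ring_hom_on markov_ring p" using p by (simp add: points_iff)
  have "p (markov_element * var_x * var_y * var_z) = p (var_x * var_x + var_y * var_y + var_z * var_z)"
    by (simp only: relation)
  then show ?thesis
    by (simp add: ring_hom_on_mult[OF hom] ring_hom_on_add[OF hom] generators_mem is_subring_mult
        is_subring_add power2_eq_square)
qed

lemma deep_if_initial_zero:
  fixes p :: "ratfun \<Rightarrow> 'k::field"
  assumes p: "p \<in> points" and zero: "p var_x = 0" "p var_y = 0" "p var_z = 0"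
  shows "p \<in> deep_points"
proof -
  have "p a = 0 \<and> p b = 0 \<and> p c = 0" if "markov_cluster a b c" for a b c
    using that by induction (auto simp: zero point_mutation[OF p])
  then show ?thesis using p by (auto simp: deep_points_def)
qed

text \<open>
  With \<open>M = 0\<close> mutation only changes signs, so the position of a vanishing variable never moves.
\<close>

lemma deep_if_markov_element_zero:
  fixes p :: "ratfun \<Rightarrow> 'k::field"
  assumes p: "p \<in> points" and M: "p markov_element = 0"
    and zero: "p var_x = 0 \<or> p var_y = 0 \<or> p var_z = 0"
  shows "p \<in> deep_points"
proof -
  have "(p a = 0 \<longleftrightarrow> p var_x = 0) \<and> (p b = 0 \<longleftrightarrow> p var_y = 0) \<and> (p c = 0 \<longleftrightarrow> p var_z = 0)"
    if "markov_cluster a b c" for a b c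
    using that by induction (auto simp: M point_mutation[OF p])
  then show ?thesis using p zero by (auto simp: deep_points_def)
qed

text \<open>
  If \<open>x\<close> vanishes at \<open>p\<close>, the cluster mutated at \<open>x\<close> has values \<open>y z M, y, z\<close>. Deepness forces \<open>y z M = 0\<close>,
  and the Markov relation forces \<open>y\<^sup>2 + z\<^sup>2 = 0\<close>: if \<open>y\<close> or \<open>z\<close> vanishes then so does the other, and otherwise
  \<open>M\<close> vanishes.
\<close>

lemma deep_point_cases:
  fixes p :: "ratfun \<Rightarrow> 'k::field"
  assumes "p \<in> deep_points"
  shows "p \<in> type_A \<or> p \<in> type_X \<or> p \<in> type_Y \<or> p \<in> type_Z"
proof -
  have p: "p \<in> points" using assms by (simp add: deep_points_def)
  have deep: "p a = 0 \<or> p b = 0 \<or> p c = 0" if "markov_cluster a b c" for a b c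
    using assms that by (auto simp: deep_points_def)
  note init = markov_cluster.initial
  note rel = point_relation[OF p] and mut = point_mutation[OF p init]
  consider "p var_x = 0" | "p var_y = 0" | "p var_z = 0" using deep[OF init] by blast
  then show ?thesis
  proof cases
    case 1
    then have "p var_y * p var_z * p markov_element = 0"
      using deep[OF mutate_1[OF init]] mut by auto
    then show ?thesis using 1 rel assms by (auto simp: type_A_def type_X_def coords_def)
  next
    case 2
    then have "p var_x * p var_z * p markov_element = 0"
      using deep[OF mutate_2[OF init]] mut by auto
    then show ?thesis using 2 rel assms by (auto simp: type_A_def type_Y_def coords_def)
  next
    case 3
    then have "p var_x * p var_y * p markov_element = 0"
      using deep[OF mutate_3[OF init]] mut by auto
    then show ?thesis using 3 rel assms by (auto simp: type_A_def type_Z_def coords_def)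
  qed
qed



theorem theorem5p7:
  shows
    "(\<forall>\<alpha>::'k::field. \<exists>p\<in>deep_points. coords p = (0, 0, 0, \<alpha>)) \<and>
     (\<forall>\<beta> \<gamma>::'k. \<beta>^2 + \<gamma>^2 = 0 \<longrightarrow> (\<exists>p\<in>deep_points. coords p = (0, \<beta>, \<gamma>, 0))) \<and>
     (\<forall>\<beta> \<gamma>::'k. \<beta>^2 + \<gamma>^2 = 0 \<longrightarrow> (\<exists>p\<in>deep_points. coords p = (\<beta>, 0, \<gamma>, 0))) \<and>
     (\<forall>\<beta> \<gamma>::'k. \<beta>^2 + \<gamma>^2 = 0 \<longrightarrow> (\<exists>p\<in>deep_points. coords p = (\<beta>, \<gamma>, 0, 0))) \<and>
     (\<forall>p \<in> (deep_points :: (ratfun \<Rightarrow> 'k) set).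
        p \<in> type_A \<or> p \<in> type_X \<or> p \<in> type_Y \<or> p \<in> type_Z) \<and>
     (\<exists>p0 :: ratfun \<Rightarrow> 'k.
        {p \<in> points. coords p = (0, 0, 0, 0)} = {p0} \<and>
        type_A \<inter> type_X = {p0} \<and> type_A \<inter> type_Y = {p0} \<and> type_A \<inter> type_Z = {p0} \<and>
        type_X \<inter> type_Y = {p0} \<and> type_X \<inter> type_Z = {p0} \<and> type_Y \<inter> type_Z = {p0})"
proof (intro conjI allI impI ballI)
  fix \<alpha> :: 'k
  obtain p where "p \<in> points" "coords p = (0, 0, 0, \<alpha>)" using point_exists[of \<alpha> 0 0 0] by auto
  then show "\<exists>p\<in>deep_points. coords p = (0, 0, 0, \<alpha>)"
    using deep_if_initial_zero by (auto simp: coords_def)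
next
  fix \<beta> \<gamma> :: 'k assume \<beta>\<gamma>: "\<beta>^2 + \<gamma>^2 = 0"
  obtain p where "p \<in> points" "coords p = (0, \<beta>, \<gamma>, 0)"
    using point_exists[of 0 0 \<beta> \<gamma>] \<beta>\<gamma> by auto
  then show "\<exists>p\<in>deep_points. coords p = (0, \<beta>, \<gamma>, 0)"
    using deep_if_markov_element_zero by (auto simp: coords_def)
  obtain p where "p \<in> points" "coords p = (\<beta>, 0, \<gamma>, 0)"
    using point_exists[of 0 \<beta> 0 \<gamma>] \<beta>\<gamma> by auto
  then show "\<exists>p\<in>deep_points. coords p = (\<beta>, 0, \<gamma>, 0)"
    using deep_if_markov_element_zero by (auto simp: coords_def)
  obtain p where "p \<in> points" "coords p = (\<beta>, \<gamma>, 0, 0)"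
    using point_exists[of 0 \<beta> \<gamma> 0] \<beta>\<gamma> by auto
  then show "\<exists>p\<in>deep_points. coords p = (\<beta>, \<gamma>, 0, 0)"
    using deep_if_markov_element_zero by (auto simp: coords_def)
next
  fix p :: "ratfun \<Rightarrow> 'k" assume "p \<in> deep_points"
  then show "p \<in> type_A \<or> p \<in> type_X \<or> p \<in> type_Y \<or> p \<in> type_Z" by (rule deep_point_cases)
next
  obtain p0 :: "ratfun \<Rightarrow> 'k" where p0: "p0 \<in> points" "coords p0 = (0, 0, 0, 0)"
    using point_exists[of 0 0 0 0] by auto
  have deep0: "p0 \<in> deep_points" using p0 deep_if_initial_zero by (auto simp: coords_def)
  have eq0: "p = p0" if "p \<in> points" "coords p = (0, 0, 0, 0)" for p
    using point_unique that p0 by metis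
  have types: "p0 \<in> type_A" "p0 \<in> type_X" "p0 \<in> type_Y" "p0 \<in> type_Z"
    using deep0 p0 by (auto simp: type_A_def type_X_def type_Y_def type_Z_def)
  have eq: "p = p0" if "p \<in> deep_points" "coords p = (0, 0, 0, 0)" for p
    using that eq0 by (auto simp: deep_points_def)
  show "\<exists>p0 :: ratfun \<Rightarrow> 'k.
        {p \<in> points. coords p = (0, 0, 0, 0)} = {p0} \<and>
        type_A \<inter> type_X = {p0} \<and> type_A \<inter> type_Y = {p0} \<and> type_A \<inter> type_Z = {p0} \<and>
        type_X \<inter> type_Y = {p0} \<and> type_X \<inter> type_Z = {p0} \<and> type_Y \<inter> type_Z = {p0}"
  proof (intro exI[of _ p0] conjI)
    show "{p \<in> points. coords p = (0, 0, 0, 0)} = {p0}" using p0 eq0 by blast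
  qed (use types in \<open>auto intro!: eq simp: type_A_def type_X_def type_Y_def type_Z_def\<close>)
qed

end
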